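(* Let $M$ be a connected orientable smooth manifold of dimension $2n\ge 4$ and let $f\colon M\to\mathbb{R}^{2n+1}$ be a non-degenerate affine hypersurface with a locally equiaffine transversal vector field $\xi$; let $\nabla$, $S$ and $R$ be the induced connection, the shape operator and the curvature tensor of $\nabla$. Let $\omega$ be an almost symplectic form on $M$. If $R^k\omega=0$ on $M$ for some integer $k\ge 1$, then the shape operator $S$ has rank $\le 1$ (i.e. $\operatorname{rank} S_x\le 1$ for every $x\in M$).
   Context: Affine hypersurfaces: for an immersion $f\colon M\to\mathbb{R}^{2n+1}$, $\dim M=2n$, with a transversal vector field $\xi$ and the standard flat connection $\mathrm{D}$ of $\mathbb{R}^{2n+1}$, the formulas $\mathrm{D}_Xf_*Y=f_*(\nabla_XY)+h(X,Y)\xi$ and $\mathrm{D}_X\xi=-f_*(SX)+\tau(X)\xi$ define the induced torsion-free connection $\nabla$, the symmetric bilinear form $h$ (second fundamental form), the $(1,1)$-tensor $S$ (shape operator) and the $1$-form $\tau$. The curvature tensor $R$ of $\nabla$ satisfies the Gauss equation $R(X,Y)Z=h(Y,Z)SX-h(X,Z)SY$. The hypersurface is non-degenerate if $h$ is non-degenerate; $\xi$ is locally equiaffine if $d\tau=0$ (equivalently $h(SX,Y)=h(X,SY)$). An almost symplectic form is a non-degenerate $2$-form (not necessarily closed). Powers of $R$: for a $(0,p)$-tensor $T$, $R\cdot T$ is the $(0,p+2)$-tensor $(R\cdot T)(X_1,X_2,\ldots,X_{p+2})=-\sum_{i=3}^{p+2}T(X_3,\ldots,R(X_1,X_2)X_i,\ldots,X_{p+2})$;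 $R^0T=T$ and $R^kT=R\cdot(R^{k-1}T)$. *)

theory Defs
  imports "HOL-Analysis.Analysis"
begin

section \<open>Smooth maps between open subsets of normed spaces\<close>

primrec Ck_on :: "nat \<Rightarrow> 'a::real_normed_vector set \<Rightarrow> ('a \<Rightarrow> 'b::real_normed_vector) \<Rightarrow> bool" where
  "Ck_on 0 W g \<longleftrightarrow> continuous_on W g"
| "Ck_on (Suc k) W g \<longleftrightarrow>
     (\<forall>y\<in>W. g differentiable (at y)) \<and>
     (\<forall>v. Ck_on k W (\<lambda>y. frechet_derivative g (at y) v))"

definition smooth_on :: "'a::real_normed_vector set \<Rightarrow> ('a \<Rightarrow> 'b::real_normed_vector) \<Rightarrow> bool" where
  "smooth_on W g \<longleftrightarrow> (\<forall>k. Ck_on k W g)"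


section \<open>Smooth manifolds\<close>

type_synonym ('m, 'n) chart = "'m set \<times> ('m \<Rightarrow> real ^ 'n)"

abbreviation chart_dom :: "('m, 'n) chart \<Rightarrow> 'm set" where
  "chart_dom c \<equiv> fst c"

abbreviation coord :: "('m, 'n) chart \<Rightarrow> 'm \<Rightarrow> real ^ 'n" where
  "coord c \<equiv> snd c"

abbreviation chart_inv :: "('m, 'n) chart \<Rightarrow> real ^ 'n \<Rightarrow> 'm" where
  "chart_inv c \<equiv> inv_into (chart_dom c) (coord c)"

definition smooth_atlas :: "'m topology \<Rightarrow> ('m, 'n::finite) chart set \<Rightarrow> bool" where
  "smooth_atlas M A \<longleftrightarrow>
     (\<Union>c\<in>A. chart_dom c) = topspace M \<and>
     (\<forall>c\<in>A. openin M (chart_dom c) \<and> open (coord c ` chart_dom c) \<and>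
        homeomorphic_map (subtopology M (chart_dom c))
          (top_of_set (coord c ` chart_dom c)) (coord c)) \<and>
     (\<forall>c\<in>A. \<forall>c'\<in>A. smooth_on (coord c ` (chart_dom c \<inter> chart_dom c')) (coord c' \<circ> chart_inv c))"

definition smooth_manifold :: "'m topology \<Rightarrow> ('m, 'n::finite) chart set \<Rightarrow> bool" where
  "smooth_manifold M A \<longleftrightarrow> Hausdorff_space M \<and> second_countable M \<and> smooth_atlas M A"

text \<open>An oriented atlas \<open>B\<close> belongs to the smooth structure of \<open>A\<close> iff \<open>A \<union> B\<close> is a smooth atlas.\<close>

definition orientable :: "'m topology \<Rightarrow> ('m, 'n::finite) chart set \<Rightarrow> bool" where
  "orientable M A \<longleftrightarrow>
     (\<exists>B. smooth_atlas M B \<and> smooth_atlas M (A \<union> B) \<and>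
        (\<forall>c\<in>B. \<forall>c'\<in>B. \<forall>x\<in>chart_dom c \<inter> chart_dom c'.
           det (matrix (frechet_derivative (coord c' \<circ> chart_inv c) (at (coord c x)))) > 0))"

definition smooth_map :: "('m, 'n::finite) chart set \<Rightarrow> 'm set \<Rightarrow> ('m \<Rightarrow> 'b::real_normed_vector) \<Rightarrow> bool" where
  "smooth_map A U g \<longleftrightarrow> (\<forall>c\<in>A. smooth_on (coord c ` (U \<inter> chart_dom c)) (g \<circ> chart_inv c))"


section \<open>Tangent vectors, vector fields, forms\<close>

text \<open>The tangent space at every point \<open>x\<close> is modelled on \<open>real ^ 'n\<close>: a vector \<open>v\<close> stands for the
  tangent vector whose components in the chart \<open>chart_at A x\<close> are \<open>v\<close>. The chart is chosen separately
  for each point, so smoothness of a vector field is not smoothness of the bare function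
  \<open>'m \<Rightarrow> real ^ 'n\<close>; it is expressed below through the components in a fixed chart.\<close>

definition chart_at :: "('m, 'n) chart set \<Rightarrow> 'm \<Rightarrow> ('m, 'n) chart" where
  "chart_at A x = (SOME c. c \<in> A \<and> x \<in> chart_dom c)"

text \<open>\<open>tangent_map A g x v\<close> is the differential of the vector-valued map \<open>g\<close> at \<open>x\<close> applied to \<open>v\<close>. For
  \<open>g = f\<close> this is \<open>f\<^sub>*v\<close>; for a field \<open>g\<close> along \<open>f\<close> it is \<open>D\<^sub>v g\<close>, with \<open>D\<close> the standard flat connection;
  for \<open>g = coord c\<close> it is the component vector of \<open>v\<close> in the chart \<open>c\<close>.\<close>

definition tangent_map ::
    "('m, 'n::finite) chart set \<Rightarrow> ('m \<Rightarrow> 'b::real_normed_vector) \<Rightarrow> 'm \<Rightarrow> real ^ 'n \<Rightarrow> 'b" where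
  "tangent_map A g x v =
     frechet_derivative (g \<circ> chart_inv (chart_at A x)) (at (coord (chart_at A x) x)) v"

definition smooth_vector_field :: "('m, 'n::finite) chart set \<Rightarrow> 'm set \<Rightarrow> ('m \<Rightarrow> real ^ 'n) \<Rightarrow> bool" where
  "smooth_vector_field A U X \<longleftrightarrow>
     (\<forall>c\<in>A. smooth_map A (U \<inter> chart_dom c) (\<lambda>x. tangent_map A (coord c) x (X x)))"

text \<open>\<open>[X, Y]\<^sup>i = X (Y\<^sup>i) - Y (X\<^sup>i)\<close>, in the components given by \<open>chart_at A x\<close>.\<close>

definition lie_bracket ::
    "('m, 'n::finite) chart set \<Rightarrow> ('m \<Rightarrow> real ^ 'n) \<Rightarrow> ('m \<Rightarrow> real ^ 'n) \<Rightarrow> 'm \<Rightarrow> real ^ 'n" where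
  "lie_bracket A X Y x =
     (let \<phi> = coord (chart_at A x)
      in tangent_map A (\<lambda>y. tangent_map A \<phi> y (Y y)) x (X x)
         - tangent_map A (\<lambda>y. tangent_map A \<phi> y (X y)) x (Y x))"

text \<open>Vanishing of \<open>d\<tau>(X, Y) = X(\<tau>(Y)) - Y(\<tau>(X)) - \<tau>([X, Y])\<close>.\<close>

definition closed_one_form ::
    "'m topology \<Rightarrow> ('m, 'n::finite) chart set \<Rightarrow> ('m \<Rightarrow> real ^ 'n \<Rightarrow> real) \<Rightarrow> bool" where
  "closed_one_form M A \<tau> \<longleftrightarrow>
     (\<forall>U X Y. openin M U \<and> smooth_vector_field A U X \<and> smooth_vector_field A U Y \<longrightarrow>
        (\<forall>x\<in>U. tangent_map A (\<lambda>y. \<tau> y (Y y)) x (X x) - tangent_map A (\<lambda>y. \<tau> y (X y)) x (Y x)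
                - \<tau> x (lie_bracket A X Y x) = 0))"

definition nondegenerate :: "'m topology \<Rightarrow> ('m \<Rightarrow> real ^ 'n \<Rightarrow> real ^ 'n \<Rightarrow> real) \<Rightarrow> bool" where
  "nondegenerate M b \<longleftrightarrow> (\<forall>x\<in>topspace M. \<forall>u. (\<forall>v. b x u v = 0) \<longrightarrow> u = 0)"

definition almost_symplectic_form ::
    "'m topology \<Rightarrow> ('m, 'n::finite) chart set \<Rightarrow> ('m \<Rightarrow> real ^ 'n \<Rightarrow> real ^ 'n \<Rightarrow> real) \<Rightarrow> bool" where
  "almost_symplectic_form M A \<omega> \<longleftrightarrow>
     (\<forall>x\<in>topspace M. bilinear (\<omega> x) \<and> (\<forall>u. \<omega> x u u = 0)) \<and>
     (\<forall>U X Y. openin M U \<and> smooth_vector_field A U X \<and> smooth_vector_field A U Y \<longrightarrow>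
        smooth_map A U (\<lambda>x. \<omega> x (X x) (Y x))) \<and>
     nondegenerate M \<omega>"


section \<open>Affine hypersurfaces\<close>

definition immersion :: "'m topology \<Rightarrow> ('m, 'n::finite) chart set \<Rightarrow> ('m \<Rightarrow> real ^ 'k) \<Rightarrow> bool" where
  "immersion M A f \<longleftrightarrow>
     smooth_map A (topspace M) f \<and> (\<forall>x\<in>topspace M. inj (tangent_map A f x))"

definition transversal_field ::
    "'m topology \<Rightarrow> ('m, 'n::finite) chart set \<Rightarrow> ('m \<Rightarrow> real ^ 'k) \<Rightarrow> ('m \<Rightarrow> real ^ 'k) \<Rightarrow> bool" where
  "transversal_field M A f \<xi> \<longleftrightarrow>
     smooth_map A (topspace M) \<xi> \<and>
     (\<forall>x\<in>topspace M. span (insert (\<xi> x) (range (tangent_map A f x))) = UNIV)"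

text \<open>The formulas of Gauss and Weingarten. They determine the connection \<open>\<nabla>\<^sub>X Y\<close> on \<open>U\<close> for vector fields \<open>X, Y\<close> smooth on
  an open set \<open>U\<close>, and they determine \<open>h\<close>, \<open>S\<close>, \<open>\<tau>\<close> at every point of \<open>M\<close>; the values of \<open>nabla\<close> elsewhere
  or on non-smooth arguments are irrelevant. Local vector fields are used because they always extend a
  given tangent vector.\<close>

definition induced_objects ::
    "'m topology \<Rightarrow> ('m, 'n::finite) chart set \<Rightarrow> ('m \<Rightarrow> real ^ 'k) \<Rightarrow> ('m \<Rightarrow> real ^ 'k)
     \<Rightarrow> (('m \<Rightarrow> real ^ 'n) \<Rightarrow> ('m \<Rightarrow> real ^ 'n) \<Rightarrow> 'm \<Rightarrow> real ^ 'n)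
     \<Rightarrow> ('m \<Rightarrow> real ^ 'n \<Rightarrow> real ^ 'n \<Rightarrow> real)
     \<Rightarrow> ('m \<Rightarrow> real ^ 'n \<Rightarrow> real ^ 'n)
     \<Rightarrow> ('m \<Rightarrow> real ^ 'n \<Rightarrow> real) \<Rightarrow> bool" where
  "induced_objects M A f \<xi> nabla h S \<tau> \<longleftrightarrow>
     (\<forall>U X Y. openin M U \<and> smooth_vector_field A U X \<and> smooth_vector_field A U Y \<longrightarrow>
        (\<forall>x\<in>U. tangent_map A (\<lambda>y. tangent_map A f y (Y y)) x (X x)
                = tangent_map A f x (nabla X Y x) + h x (X x) (Y x) *\<^sub>R \<xi> x)) \<and>
     (\<forall>x\<in>topspace M. \<forall>v. tangent_map A \<xi> x v = - tangent_map A f x (S x v) + \<tau> x v *\<^sub>R \<xi> x)"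

definition curvature_tensor ::
    "'m topology \<Rightarrow> ('m, 'n::finite) chart set
     \<Rightarrow> (('m \<Rightarrow> real ^ 'n) \<Rightarrow> ('m \<Rightarrow> real ^ 'n) \<Rightarrow> 'm \<Rightarrow> real ^ 'n)
     \<Rightarrow> ('m \<Rightarrow> real ^ 'n \<Rightarrow> real ^ 'n \<Rightarrow> real ^ 'n \<Rightarrow> real ^ 'n) \<Rightarrow> bool" where
  "curvature_tensor M A nabla R \<longleftrightarrow>
     (\<forall>U X Y Z. openin M U \<and> smooth_vector_field A U X \<and> smooth_vector_field A U Y \<and>
          smooth_vector_field A U Z \<longrightarrow>
        (\<forall>x\<in>U. R x (X x) (Y x) (Z x)
                = nabla X (nabla Y Z) x - nabla Y (nabla X Z) x - nabla (lie_bracket A X Y) Z x))"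


section \<open>Powers of the curvature tensor\<close>

text \<open>A \<open>(0, p)\<close>-tensor at a point is a function on the lists of \<open>p\<close> tangent vectors; its values on lists
  of other lengths carry no meaning.\<close>

fun curvature_action ::
    "('m \<Rightarrow> 'v \<Rightarrow> 'v \<Rightarrow> 'v \<Rightarrow> 'v) \<Rightarrow> ('m \<Rightarrow> 'v list \<Rightarrow> real) \<Rightarrow> 'm \<Rightarrow> 'v list \<Rightarrow> real" where
  "curvature_action R T x (X1 # X2 # Xs) =
     - (\<Sum>i<length Xs. T x (Xs[i := R x X1 X2 (Xs ! i)]))"
| "curvature_action R T x _ = 0"

definition curvature_power ::
    "('m \<Rightarrow> 'v \<Rightarrow> 'v \<Rightarrow> 'v \<Rightarrow> 'v) \<Rightarrow> nat \<Rightarrow> ('m \<Rightarrow> 'v list \<Rightarrow> real) \<Rightarrow> 'm \<Rightarrow> 'v list \<Rightarrow> real" where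
  "curvature_power R k T = (curvature_action R ^^ k) T"

definition form_tensor :: "('m \<Rightarrow> 'v \<Rightarrow> 'v \<Rightarrow> real) \<Rightarrow> 'm \<Rightarrow> 'v list \<Rightarrow> real" where
  "form_tensor \<omega> x Xs = \<omega> x (Xs ! 0) (Xs ! 1)"

end

theory Submission
  imports Defs
begin

text \<open>
  The proof has an algebraic and a differential-geometric half, joined at one point \<open>x\<close>.

  Geometry. In the chart chosen at \<open>x\<close> the immersion becomes a smooth map \<open>F\<close> on an open set of
  \<open>\<real>\<^sup>2\<^sup>n\<close>, and \<open>\<partial>\<^sub>1F, \<dots>, \<partial>\<^sub>2\<^sub>nF, \<xi>\<close> is a frame of \<open>\<real>\<^sup>2\<^sup>n\<^sup>+\<^sup>1\<close>. Comparing components in this frame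
  of the symmetric third derivatives of \<open>F\<close> gives the Gauss equation
  \<open>R(X,Y)Z = h(Y,Z) SX - h(X,Z) SY\<close>, and of the symmetric second derivatives of \<open>\<xi>\<close>, together with
  \<open>d\<tau> = 0\<close>, the \<open>h\<close>-selfadjointness of \<open>S\<close> (\<open>pointwise_equations\<close>). From here on only linear algebra
  on a single tangent space of dimension \<open>m \<ge> 4\<close> is used.

  Algebra. Put \<open>\<sigma>(X,Y) = h(SX,Y)\<close>. If \<open>R\<^sup>k\<^sup>+\<^sup>2\<omega> = 0\<close>, fix all but the first two slots of \<open>R\<^sup>k\<^sup>+\<^sup>1\<omega>\<close> to
  obtain a skew bilinear form \<open>\<beta>\<close>. Antisymmetrizing \<open>R(X,Y)\<cdot>R(Z,W)\<cdot>R\<^sup>k\<omega>\<close> in the two pairs leaves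
  only the commutator \<open>[R(X,Y), R(Z,W)]\<close>, which is a combination of operators \<open>R(U,V)\<close> with
  coefficients from \<open>\<sigma>\<close>; this yields the quadratic relation \<open>\<sigma> \<and> \<beta> = h \<and> \<epsilon>\<close> with
  \<open>\<epsilon>(X,W) = \<beta>(SX,W) + \<beta>(X,SW)\<close> (\<open>second_action_relation\<close>). Its \<open>h\<close>-trace says
  \<open>(m - 1) \<epsilon> = (tr S) \<beta>\<close>, so with \<open>\<kappa> = tr S / (m - 1)\<close> the form \<open>\<delta> = \<sigma> - \<kappa> h\<close> satisfies
  \<open>\<delta> \<and> \<beta> = 0\<close>. A nonzero \<open>\<beta>\<close> is then decomposable, and \<open>S = \<kappa>\<close> on its kernel, which has codimension
  two. Letting the remaining slots vary, either two kernels differ, and \<open>S = \<kappa>\<close> on a hyperplane, or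
  the common kernel is invariant under all \<open>R(U,V)\<close>. In this way a nonzero \<open>R\<^sup>k\<^sup>+\<^sup>1\<omega>\<close> leaves, for
  \<open>rank S \<ge> 2\<close>, only two shapes of \<open>S\<close> (\<open>exceptional_shapes\<close>): \<open>\<kappa>\<close> times a projection onto a
  hyperplane, or \<open>S\<^sup>2 = 0\<close>.

  Both shapes contradict \<open>R\<^sup>k\<^sup>+\<^sup>2\<omega> = 0\<close> directly. In the first, \<open>R\<close> restricted to the image of \<open>S\<close> has
  constant curvature; the traced relation descends all the way to \<open>\<omega>\<close> and shows that \<open>\<omega>\<close> vanishes
  on a hyperplane (\<open>projection_case_impossible\<close>). In the second, there are \<open>h\<close>-isotropic planes
  \<open>span {X, Y}\<close> on which \<open>\<sigma>\<close> is non-degenerate; \<open>R(X,Y)\<close> kills \<open>X\<close> and \<open>Y\<close>, so that repeating this pair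
  in \<open>R\<^sup>k\<^sup>+\<^sup>2\<omega>\<close> evaluates to a power of \<open>R(X,Y)\<close> inside \<open>\<omega>\<close> (\<open>nilpotent_case_impossible\<close>). Outside the two
  shapes the exponent decreases to one, and \<open>R\<omega> = 0\<close> forces \<open>S = 0\<close> by one more trace
  (\<open>annihilated_form_imp_S_zero\<close>).
\<close>

section \<open>Powers of a curvature operator on tensors at a point\<close>

text \<open>The operation \<open>T \<mapsto> R \<cdot> T\<close> at one point. The formula reads the arguments by position instead of
  by pattern, so that it needs no default value; it is evaluated only on lists with at least two
  entries.\<close>

definition tensor_action :: "('v \<Rightarrow> 'v \<Rightarrow> 'v \<Rightarrow> 'v) \<Rightarrow> ('v list \<Rightarrow> real) \<Rightarrow> 'v list \<Rightarrow> real" where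
  "tensor_action r T Xs =
     - (\<Sum>i<length Xs - 2. T ((drop 2 Xs)[i := r (Xs ! 0) (Xs ! 1) (Xs ! (i + 2))]))"

lemma tensor_action_Cons2 [simp]:
  "tensor_action r T (X # Y # L) = - (\<Sum>i<length L. T (L[i := r X Y (L ! i)]))"
  by (simp add: tensor_action_def)

text \<open>\<open>R\<^sup>k\<omega>\<close> involves no derivatives, so its value at \<open>x\<close> depends on \<open>R\<close> and \<open>\<omega>\<close> at \<open>x\<close> alone. This is what
  reduces the algebraic half to a single tangent space.\<close>

lemma curvature_power_pointwise:
  assumes "length Xs = 2 * k + 2"
  shows "curvature_power R k (form_tensor \<omega>) x Xs =
    (tensor_action (R x) ^^ k) (\<lambda>L. \<omega> x (L ! 0) (L ! 1)) Xs"
  using assms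
proof (induction k arbitrary: Xs)
  case 0
  then show ?case by (simp add: curvature_power_def form_tensor_def)
next
  case (Suc k)
  then obtain X Y L where Xs: "Xs = X # Y # L" and L: "length L = 2 * k + 2"
    by (cases Xs; cases "tl Xs") auto
  have "curvature_power R (Suc k) (form_tensor \<omega>) x Xs =
      - (\<Sum>i<length L. curvature_power R k (form_tensor \<omega>) x (L[i := R x X Y (L ! i)]))"
    by (simp add: Xs curvature_power_def)
  also have "\<dots> = (tensor_action (R x) ^^ Suc k) (\<lambda>L. \<omega> x (L ! 0) (L ! 1)) Xs"
    by (simp add: Xs Suc.IH L)
  finally show ?case .
qed

text \<open>Tensors are functions on lists; linearity is demanded in each slot of lists of the length that
  carries meaning.\<close>

definition multilinear_on_lists :: "nat \<Rightarrow> ('v::real_vector list \<Rightarrow> real) \<Rightarrow> bool" where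
  "multilinear_on_lists p T \<longleftrightarrow> (\<forall>L i. length L = p \<and> i < p \<longrightarrow> linear (\<lambda>v. T (L[i := v])))"

lemma multilinear_on_listsD:
  "multilinear_on_lists p T \<Longrightarrow> length L = p \<Longrightarrow> i < p \<Longrightarrow> linear (\<lambda>v. T (L[i := v]))"
  by (simp add: multilinear_on_lists_def)

lemma multilinear_on_lists_zero:
  assumes "multilinear_on_lists p T" "length L = p" "i < p"
  shows "T (L[i := 0]) = 0"
  using linear_0[OF multilinear_on_listsD[OF assms]] by simp

lemma multilinear_form:
  assumes "bilinear b"
  shows "multilinear_on_lists 2 (\<lambda>L. b (L ! 0) (L ! 1))"
  unfolding multilinear_on_lists_def
proof (intro allI impI, elim conjE)
  fix L :: "'a list" and i :: nat
  assume "length L = 2" "i < 2"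
  then show "linear (\<lambda>v. b (L[i := v] ! 0) (L[i := v] ! 1))"
    using assms by (cases "i = 0") (auto simp: bilinear_def less_2_cases_iff)
qed

lemma linear_uminus_sum:
  fixes f :: "'i \<Rightarrow> 'v::real_vector \<Rightarrow> real"
  assumes "\<And>i. i \<in> I \<Longrightarrow> linear (f i)"
  shows "linear (\<lambda>v. - (\<Sum>i\<in>I. f i v))"
  using linear_compose_neg[OF linear_compose_sum[of I f]] assms by simp

lemma multilinear_tensor_action:
  assumes T: "multilinear_on_lists p T"
    and r1: "\<And>Y Z. linear (\<lambda>X. r X Y Z)" and r2: "\<And>X Z. linear (\<lambda>Y. r X Y Z)"
    and r3: "\<And>X Y. linear (r X Y)"
  shows "multilinear_on_lists (Suc (Suc p)) (tensor_action r T)"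
  unfolding multilinear_on_lists_def
proof (intro allI impI, elim conjE)
  fix Xs :: "'a list" and i :: nat
  assume len: "length Xs = Suc (Suc p)" and i: "i < Suc (Suc p)"
  then obtain X Y L where Xs: "Xs = X # Y # L" and L: "length L = p"
    by (cases Xs; cases "tl Xs") auto
  note lin = linear_compose[unfolded o_def]
  consider "i = 0" | "i = 1" | j where "i = Suc (Suc j)" "j < p"
    using i by (metis One_nat_def less_Suc_eq_0_disj Suc_less_eq not0_implies_Suc)
  then show "linear (\<lambda>v. tensor_action r T (Xs[i := v]))"
  proof cases
    case 1
    then show ?thesis
      by (auto simp: Xs L intro!: linear_uminus_sum lin[OF r1 multilinear_on_listsD[OF T L]])
  next
    case 2
    then show ?thesis
      by (auto simp: Xs L intro!: linear_uminus_sum lin[OF r2 multilinear_on_listsD[OF T L]])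
  next
    case 3
    have "linear (\<lambda>v. T (L[j := v, l := r X Y (L[j := v] ! l)]))" if "l < p" for l
    proof (cases "l = j")
      case True
      then show ?thesis
        using lin[OF r3 multilinear_on_listsD[OF T L that]] that by (simp add: L)
    next
      case False
      then show ?thesis
        using multilinear_on_listsD[OF T, of "L[l := r X Y (L ! l)]" j] 3
        by (simp add: L list_update_swap)
    qed
    then show ?thesis
      using 3 by (auto simp: Xs L intro!: linear_uminus_sum)
  qed
qed

text \<open>Fewer linear equations than unknowns: each functional is the inner product with a vector, and some
  nonzero vector is orthogonal to all of these.\<close>

lemma common_kernel_nontrivial:
  fixes f :: "'i \<Rightarrow> 'v::euclidean_space \<Rightarrow> real"
  assumes lin: "\<And>i. i \<in> I \<Longrightarrow> linear (f i)" and "finite I" "card I < DIM('v)"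
  obtains X where "X \<noteq> 0" "\<And>i. i \<in> I \<Longrightarrow> f i X = 0"
proof -
  define g where "g i = (\<Sum>b\<in>Basis. f i b *\<^sub>R b)" for i
  have g: "f i X = X \<bullet> g i" if "i \<in> I" for i X
  proof -
    have "f i X = f i (\<Sum>b\<in>Basis. (X \<bullet> b) *\<^sub>R b)"
      by (simp add: euclidean_representation)
    also have "\<dots> = (\<Sum>b\<in>Basis. (X \<bullet> b) * f i b)"
      by (simp add: linear_sum[OF lin[OF that]] linear_scale[OF lin[OF that]])
    also have "\<dots> = X \<bullet> g i"
      by (simp add: g_def inner_sum_right mult.commute)
    finally show ?thesis .
  qed
  have "dim (g ` I) < DIM('v)"
    using dim_le_card'[of "g ` I"] card_image_le[of I g] assms by simp
  then obtain X where "X \<noteq> 0" "\<And>y. y \<in> span (g ` I) \<Longrightarrow> orthogonal X y"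
    by (rule orthogonal_to_subspace_exists) auto
  then show ?thesis
    using that[of X] g by (auto simp: orthogonal_def span_base)
qed

text \<open>A tangent space with the data that the structure equations leave at a point: a non-degenerate
  symmetric \<open>h\<close> of arbitrary signature and an \<open>h\<close>-selfadjoint \<open>S\<close>. The curvature is then defined by the
  Gauss equation.\<close>

locale gauss_curvature =
  fixes h :: "'v::euclidean_space \<Rightarrow> 'v \<Rightarrow> real" and S :: "'v \<Rightarrow> 'v"
  assumes h_bilinear: "bilinear h" and h_sym: "h u v = h v u"
    and h_nondegenerate: "(\<And>v. h u v = 0) \<Longrightarrow> u = 0"
    and S_linear: "linear S" and S_selfadjoint: "h (S u) v = h u (S v)"
begin

definition R :: "'v \<Rightarrow> 'v \<Rightarrow> 'v \<Rightarrow> 'v" where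
  "R X Y Z = h Y Z *\<^sub>R S X - h X Z *\<^sub>R S Y"

lemmas h_simps = bilinear_ladd[OF h_bilinear] bilinear_radd[OF h_bilinear]
  bilinear_lsub[OF h_bilinear] bilinear_rsub[OF h_bilinear]
  bilinear_lmul[OF h_bilinear] bilinear_rmul[OF h_bilinear]
  bilinear_lneg[OF h_bilinear] bilinear_rneg[OF h_bilinear]
  bilinear_lzero[OF h_bilinear] bilinear_rzero[OF h_bilinear]

lemmas S_simps = linear_add[OF S_linear] linear_diff[OF S_linear] linear_scale[OF S_linear]
  linear_0[OF S_linear]

lemma R_linear: "linear (\<lambda>X. R X Y Z)" "linear (\<lambda>Y. R X Y Z)" "linear (R X Y)"
  by (auto simp: R_def h_simps S_simps algebra_simps intro!: linearI)

lemma R_skew: "R Y X Z = - R X Y Z"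
  by (simp add: R_def)

abbreviation Rpow :: "nat \<Rightarrow> ('v list \<Rightarrow> real) \<Rightarrow> 'v list \<Rightarrow> real" where
  "Rpow k \<equiv> tensor_action R ^^ k"

lemma multilinear_Rpow:
  assumes "multilinear_on_lists p T"
  shows "multilinear_on_lists (2 * k + p) (Rpow k T)"
  by (induction k) (simp_all add: assms multilinear_tensor_action[OF _ R_linear])

lemma tensor_action_R_bilinear:
  assumes "multilinear_on_lists (length L) T"
  shows "bilinear (\<lambda>X Y. tensor_action R T (X # Y # L))"
    and "tensor_action R T (Y # X # L) = - tensor_action R T (X # Y # L)"
proof -
  have M: "multilinear_on_lists (Suc (Suc (length L))) (tensor_action R T)"
    by (rule multilinear_tensor_action[OF assms R_linear])
  show "bilinear (\<lambda>X Y. tensor_action R T (X # Y # L))"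
    using multilinear_on_listsD[OF M, of "[_, _] @ L" 0] multilinear_on_listsD[OF M, of "[_, _] @ L" 1]
    by (simp add: bilinear_def del: tensor_action_Cons2)
  have "T (L[i := R Y X (L ! i)]) = - T (L[i := R X Y (L ! i)])" if "i < length L" for i
    using linear_neg[OF multilinear_on_listsD[OF assms refl that]] by (simp add: R_skew[of Y X])
  then show "tensor_action R T (Y # X # L) = - tensor_action R T (X # Y # L)"
    by (simp add: sum_negf)
qed

definition \<sigma> :: "'v \<Rightarrow> 'v \<Rightarrow> real" where "\<sigma> X Y = h (S X) Y"

lemma \<sigma>_sym: "\<sigma> X Y = \<sigma> Y X"
  unfolding \<sigma>_def by (metis S_selfadjoint h_sym)

lemma \<sigma>_eq: "h (S X) Y = \<sigma> X Y" "h X (S Y) = \<sigma> X Y"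
  unfolding \<sigma>_def by (simp_all add: S_selfadjoint)

text \<open>\<open>R(X,Y) = S \<circ> (X \<and> Y)\<close> with \<open>X \<and> Y\<close> in \<open>so(h)\<close>. For skew \<open>B, B'\<close> the map
  \<open>BSB' - B'SB\<close> is skew again because \<open>S\<close> is selfadjoint, so the operators \<open>R(X,Y)\<close> span a Lie algebra;
  its structure constants are values of \<open>\<sigma>\<close>.\<close>

lemma R_commutator:
  "R Z W (R X Y v) - R X Y (R Z W v) =
     \<sigma> X W *\<^sub>R R Z Y v - \<sigma> Y W *\<^sub>R R Z X v - \<sigma> X Z *\<^sub>R R W Y v + \<sigma> Y Z *\<^sub>R R W X v"
  by (simp add: R_def h_simps S_simps \<sigma>_eq \<sigma>_sym[of Z X] \<sigma>_sym[of W X] \<sigma>_sym[of Z Y] \<sigma>_sym[of W Y]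
      algebra_simps)

text \<open>If \<open>R \<cdot> (R \<cdot> T) = 0\<close>, then \<open>R(X,Y)\<cdot>(R(Z,W)\<cdot>T)\<close> equals the correction term in which \<open>R(X,Y)\<close> acts
  on \<open>Z\<close> and \<open>W\<close>. Subtracting the same equation with the pairs exchanged replaces the left side by the
  action of a commutator, hence by a value of \<open>R \<cdot> T\<close> itself, and \<open>T\<close> disappears from the equation. Only
  two values of \<open>R \<cdot> (R \<cdot> T)\<close> enter, so the relation can also be used where this tensor vanishes just on
  the vectors of a subspace.\<close>

lemma second_action_relation:
  fixes X Y Z W :: 'v
  assumes T: "multilinear_on_lists (length L) T"
    and 1: "tensor_action R (tensor_action R T) (X # Y # Z # W # L) = 0"
    and 2: "tensor_action R (tensor_action R T) (Z # W # X # Y # L) = 0"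
  defines "\<beta> \<equiv> \<lambda>U V. tensor_action R T (U # V # L)"
  defines "\<epsilon> \<equiv> \<lambda>U V. \<beta> (S U) V + \<beta> U (S V)"
  shows "\<sigma> Y Z * \<beta> X W - \<sigma> Y W * \<beta> X Z - \<sigma> X Z * \<beta> Y W + \<sigma> X W * \<beta> Y Z =
         h Y Z * \<epsilon> X W - h Y W * \<epsilon> X Z - h X Z * \<epsilon> Y W + h X W * \<epsilon> Y Z"
proof -
  define n where "n = length L"
  \<comment> \<open>the iterated derivation action of two operators, without the correction terms\<close>
  define Q where "Q A B = (\<Sum>i<n. \<Sum>j<n. T (L[i := A (L ! i), j := B (L[i := A (L ! i)] ! j)]))"
    for A B :: "'v \<Rightarrow> 'v"
  have expand: "tensor_action R (tensor_action R T) (A # B # C # D # L) =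
      Q (R A B) (R C D) - \<beta> (R A B C) D - \<beta> C (R A B D)" for A B C D
  proof -
    have "tensor_action R (tensor_action R T) (A # B # C # D # L) =
      - (\<Sum>i<Suc (Suc n). tensor_action R T ((C # D # L)[i := R A B ((C # D # L) ! i)]))"
      by (simp add: n_def)
    also have "\<dots> = - (\<beta> (R A B C) D + \<beta> C (R A B D)
        + (\<Sum>i<n. tensor_action R T (C # D # L[i := R A B (L ! i)])))"
      by (simp only: sum.lessThan_Suc_shift) (simp add: \<beta>_def)
    finally show ?thesis
      by (simp add: Q_def n_def sum_negf)
  qed
  have lin: "linear (\<lambda>v. T (L[i := v]))" if "i < n" for i
    using multilinear_on_listsD[OF T refl] that by (simp add: n_def)
  have Qsplit: "Q A B = (\<Sum>i<n. T (L[i := B (A (L ! i))]))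
      + (\<Sum>i<n. \<Sum>j\<in>{..<n} - {i}. T (L[i := A (L ! i), j := B (L ! j)]))" for A B
  proof -
    have "(\<Sum>j<n. T (L[i := A (L ! i), j := B (L[i := A (L ! i)] ! j)])) = T (L[i := B (A (L ! i))])
       + (\<Sum>j\<in>{..<n} - {i}. T (L[i := A (L ! i), j := B (L ! j)]))" if "i < n" for i
      using that by (subst sum.remove[of _ i]) (auto simp: n_def intro!: sum.cong)
    then show ?thesis
      by (simp add: Q_def sum.distrib)
  qed
  \<comment> \<open>operators acting in different slots commute, so only the diagonal terms survive in the commutator\<close>
  have swap: "(\<Sum>i<n. \<Sum>j\<in>{..<n} - {i}. T (L[i := A (L ! i), j := B (L ! j)])) =
        (\<Sum>i<n. \<Sum>j\<in>{..<n} - {i}. T (L[i := B (L ! i), j := A (L ! j)]))" for A B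
  proof -
    have "(\<Sum>i<n. \<Sum>j\<in>{..<n} - {i}. T (L[i := A (L ! i), j := B (L ! j)])) =
       (\<Sum>i<n. \<Sum>j\<in>{j. j < n \<and> i \<noteq> j}. T (L[i := A (L ! i), j := B (L ! j)]))"
      by (intro sum.cong) auto
    also have "\<dots> = (\<Sum>j<n. \<Sum>i\<in>{i. i < n \<and> i \<noteq> j}. T (L[i := A (L ! i), j := B (L ! j)]))"
      by (subst sum.swap_restrict[of "{..<n}" "{..<n}" _ "\<lambda>i j. i \<noteq> j", simplified]) auto
    also have "\<dots> = (\<Sum>i<n. \<Sum>j\<in>{..<n} - {i}. T (L[i := B (L ! i), j := A (L ! j)]))"
      by (intro sum.cong) (auto simp: list_update_swap)
    finally show ?thesis .
  qed
  have "Q (R X Y) (R Z W) - Q (R Z W) (R X Y)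
      = (\<Sum>i<n. T (L[i := R Z W (R X Y (L ! i))]) - T (L[i := R X Y (R Z W (L ! i))]))"
    by (simp add: Qsplit swap[of "R Z W"] sum_subtractf)
  also have "\<dots> = (\<Sum>i<n. \<sigma> X W * T (L[i := R Z Y (L ! i)]) - \<sigma> Y W * T (L[i := R Z X (L ! i)])
      - \<sigma> X Z * T (L[i := R W Y (L ! i)]) + \<sigma> Y Z * T (L[i := R W X (L ! i)]))"
    by (intro sum.cong refl, subst linear_diff[OF lin, symmetric], simp)
      (simp add: R_commutator linear_add[OF lin] linear_diff[OF lin] linear_scale[OF lin])
  also have "\<dots> = - \<sigma> X W * \<beta> Z Y + \<sigma> Y W * \<beta> Z X + \<sigma> X Z * \<beta> W Y - \<sigma> Y Z * \<beta> W X"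
    by (simp add: \<beta>_def n_def sum.distrib sum_subtractf sum_distrib_left[symmetric])
  finally have q: "Q (R X Y) (R Z W) - Q (R Z W) (R X Y) =
      - \<sigma> X W * \<beta> Z Y + \<sigma> Y W * \<beta> Z X + \<sigma> X Z * \<beta> W Y - \<sigma> Y Z * \<beta> W X" .
  have bil: "bilinear \<beta>" and skew: "\<beta> V U = - \<beta> U V" for U V
    unfolding \<beta>_def by (rule tensor_action_R_bilinear[OF T])+
  have "Q (R X Y) (R Z W) - Q (R Z W) (R X Y) =
      \<beta> (R X Y Z) W + \<beta> Z (R X Y W) - \<beta> (R Z W X) Y - \<beta> X (R Z W Y)"
    using 1 2 unfolding expand by simp
  also have "\<dots> = h Y Z * \<epsilon> X W - h Y W * \<epsilon> X Z - h X Z * \<epsilon> Y W + h X W * \<epsilon> Y Z"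
    by (simp add: R_def \<epsilon>_def bilinear_lsub[OF bil] bilinear_rsub[OF bil] bilinear_lmul[OF bil]
        bilinear_rmul[OF bil] h_sym[of Z] h_sym[of W] skew[of Z] skew[of "S Z"] skew[of W] skew[of "S W"]
        algebra_simps)
  finally show ?thesis
    using q by (simp add: skew[of Z] skew[of W])
qed

section \<open>Contraction with the second fundamental form\<close>

text \<open>The index-raising map of \<open>h\<close>: for a basis orthonormal for the inner product, \<open>e\<close> and \<open>sharp e\<close> run
  through \<open>h\<close>-dual bases. It lets the trace with respect to \<open>h\<close> be taken without diagonalizing \<open>h\<close>.\<close>

definition sharp :: "'v \<Rightarrow> 'v" where
  "sharp = (SOME G. linear G \<and> (\<forall>u v. h (G u) v = u \<bullet> v))"

lemma sharp: "linear sharp" "h (sharp u) v = u \<bullet> v"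
proof -
  define F where "F u = (\<Sum>b\<in>Basis. h u b *\<^sub>R b)" for u
  have F: "F u \<bullet> v = h u v" for u v
  proof -
    have "F u \<bullet> v = (\<Sum>b\<in>Basis. h u ((v \<bullet> b) *\<^sub>R b))"
      by (simp add: F_def inner_sum_left h_simps inner_commute[of v] mult.commute)
    also have "\<dots> = h u (\<Sum>b\<in>Basis. (v \<bullet> b) *\<^sub>R b)"
      using h_bilinear by (simp add: bilinear_def linear_sum)
    finally show ?thesis by (simp add: euclidean_representation)
  qed
  have lin: "linear F"
    by (rule linearI) (simp_all add: F_def h_simps algebra_simps sum.distrib scaleR_sum_right)
  have "inj F"
    unfolding linear_injective_0[OF lin] using F h_nondegenerate by (metis inner_zero_left)
  then obtain G where "linear G" "\<And>x. F (G x) = x"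
    using linear_injective_isomorphism[OF lin] by metis
  then have "\<exists>G. linear G \<and> (\<forall>u v. h (G u) v = u \<bullet> v)"
    using F by metis
  from someI_ex[OF this] show "linear sharp" "h (sharp u) v = u \<bullet> v"
    unfolding sharp_def by blast+
qed

definition contract :: "('v \<Rightarrow> 'v \<Rightarrow> real) \<Rightarrow> real" where
  "contract b = (\<Sum>e\<in>Basis. b e (sharp e))"

lemma contract_linear:
  "contract (\<lambda>Y Z. b Y Z + b' Y Z) = contract b + contract b'"
  "contract (\<lambda>Y Z. b Y Z - b' Y Z) = contract b - contract b'"
  "contract (\<lambda>Y Z. b Y Z * a) = contract b * a"
  "contract (\<lambda>Y Z. a * b Y Z) = a * contract b"
  by (simp_all add: contract_def sum.distrib sum_subtractf sum_distrib_left sum_distrib_right)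

lemma contract_h: "contract h = real DIM('v)"
  by (simp add: contract_def h_sym[of _ "sharp _"] sharp(2) inner_Basis)

lemma contract_left:
  assumes "linear f"
  shows "contract (\<lambda>Y Z. h X Z * f Y) = f X"
proof -
  have "contract (\<lambda>Y Z. h X Z * f Y) = (\<Sum>e\<in>Basis. f ((X \<bullet> e) *\<^sub>R e))"
    by (simp add: contract_def h_sym[of X] sharp(2) linear_scale[OF assms] inner_commute)
  also have "\<dots> = f X"
    by (simp add: linear_sum[OF assms, symmetric] euclidean_representation)
  finally show ?thesis .
qed

lemma contract_right:
  assumes "linear f"
  shows "contract (\<lambda>Y Z. h Y W * f Z) = f W"
proof -
  have "h (\<Sum>e\<in>Basis. h e W *\<^sub>R sharp e) v = h W v" for v
  proof -
    have lin: "linear (\<lambda>u. h u v)"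
      using h_bilinear by (simp add: bilinear_def)
    have "h (\<Sum>e\<in>Basis. h e W *\<^sub>R sharp e) v = (\<Sum>e\<in>Basis. h W ((v \<bullet> e) *\<^sub>R e))"
      by (simp add: linear_sum[OF lin] h_simps sharp(2) h_sym[of W] inner_commute[of v] mult.commute)
    also have "\<dots> = h W (\<Sum>e\<in>Basis. (v \<bullet> e) *\<^sub>R e)"
      using h_bilinear by (simp add: bilinear_def linear_sum)
    finally show ?thesis by (simp add: euclidean_representation)
  qed
  then have "(\<Sum>e\<in>Basis. h e W *\<^sub>R sharp e) = W"
    using h_nondegenerate[of "(\<Sum>e\<in>Basis. h e W *\<^sub>R sharp e) - W"] by (simp add: h_simps)
  moreover have "contract (\<lambda>Y Z. h Y W * f Z) = f (\<Sum>e\<in>Basis. h e W *\<^sub>R sharp e)"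
    by (simp add: contract_def linear_sum[OF assms] linear_scale[OF assms])
  ultimately show ?thesis by simp
qed

text \<open>The inverse metric is symmetric, and the contraction of a symmetric with a skew tensor vanishes.\<close>

lemma contract_skew:
  assumes "bilinear b" "\<And>X Y. b Y X = - b X Y"
  shows "contract b = 0"
proof -
  have eq: "b e (sharp e) = (\<Sum>c\<in>Basis. h (sharp c) (sharp e) * b e c)" for e
  proof -
    have "b e (sharp e) = b e (\<Sum>c\<in>Basis. (sharp e \<bullet> c) *\<^sub>R c)"
      by (simp add: euclidean_representation)
    also have "\<dots> = (\<Sum>c\<in>Basis. h (sharp c) (sharp e) * b e c)"
      using assms(1) by (simp add: bilinear_def linear_sum linear_scale sharp(2) inner_commute)
    finally show ?thesis .
  qed
  have "contract b = (\<Sum>e\<in>Basis. \<Sum>c\<in>Basis. h (sharp c) (sharp e) * b e c)"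
    by (simp add: contract_def eq)
  also have "\<dots> = (\<Sum>e\<in>Basis. \<Sum>c\<in>Basis. h (sharp e) (sharp c) * b c e)"
    by (rule sum.swap)
  also have "\<dots> = - (\<Sum>e\<in>Basis. \<Sum>c\<in>Basis. h (sharp c) (sharp e) * b e c)"
    unfolding sum_negf[symmetric]
    by (intro sum.cong refl) (metis assms(2) h_sym mult_minus_right)
  finally show ?thesis
    by (simp add: contract_def eq)
qed

definition trace_S :: real where "trace_S = contract \<sigma>"

text \<open>The relation \<open>\<sigma> \<and> \<beta> = h \<and> \<epsilon>\<close>, where \<open>\<and>\<close> is the Kulkarni-Nomizu product of a symmetric and a skew
  form and \<open>\<epsilon>\<close> is the image of \<open>\<beta>\<close> under \<open>S\<close> acting as a derivation.\<close>

definition commutator_identity :: "('v \<Rightarrow> 'v \<Rightarrow> real) \<Rightarrow> bool" where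
  "commutator_identity \<beta> \<longleftrightarrow> (\<forall>X Y Z W.
     \<sigma> Y Z * \<beta> X W - \<sigma> Y W * \<beta> X Z - \<sigma> X Z * \<beta> Y W + \<sigma> X W * \<beta> Y Z =
     h Y Z * (\<beta> (S X) W + \<beta> X (S W)) - h Y W * (\<beta> (S X) Z + \<beta> X (S Z))
     - h X Z * (\<beta> (S Y) W + \<beta> Y (S W)) + h X W * (\<beta> (S Y) Z + \<beta> Y (S Z)))"

lemma bilinear_linear:
  fixes \<beta> :: "'v \<Rightarrow> 'v \<Rightarrow> real"
  assumes "bilinear \<beta>"
  shows "linear (\<lambda>X. \<beta> X W)" "linear (\<lambda>W. \<beta> X W)"
    "linear (\<lambda>X. \<beta> (S X) W)" "linear (\<lambda>W. \<beta> X (S W))"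
  using assms linear_compose[OF S_linear, of "\<lambda>X. \<beta> X W"] linear_compose[OF S_linear, of "\<beta> X"]
  by (auto simp: bilinear_def o_def)

lemma bilinear_S:
  fixes \<beta> :: "'v \<Rightarrow> 'v \<Rightarrow> real"
  assumes "bilinear \<beta>"
  shows "bilinear (\<lambda>X Y. \<beta> (S X) Y)" "bilinear (\<lambda>X Y. \<beta> X (S Y))" "bilinear (\<lambda>X Y. \<beta> (S X) (S Y))"
  using assms S_linear unfolding bilinear_def
  by (auto simp: linear_iff S_simps)

text \<open>The contraction of the commutator identity in \<open>Y\<close> and \<open>Z\<close>. The terms \<open>\<beta>(Y,Z)\<close> and \<open>\<epsilon>(Y,Z)\<close> drop out as
  traces of skew forms; the mixed terms reproduce \<open>\<epsilon>\<close>.\<close>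

lemma derivation_eq_trace:
  assumes bil: "bilinear \<beta>" and skew: "\<And>X Y. \<beta> Y X = - \<beta> X Y" and "commutator_identity \<beta>"
  shows "(real DIM('v) - 1) * (\<beta> (S X) W + \<beta> X (S W)) = trace_S * \<beta> X W"
proof -
  define \<epsilon> where "\<epsilon> X W = \<beta> (S X) W + \<beta> X (S W)" for X W
  have bil_\<epsilon>: "bilinear \<epsilon>"
    using bilinear_S[OF bil] by (auto simp: bilinear_def \<epsilon>_def intro: linear_compose_add)
  have skew_\<epsilon>: "\<epsilon> Y X = - \<epsilon> X Y" for X Y
    using skew[of X "S Y"] skew[of "S X" Y] by (simp add: \<epsilon>_def)
  have "contract (\<lambda>Y Z. \<sigma> Y Z * \<beta> X W - h Y (S W) * \<beta> X Z - h (S X) Z * \<beta> Y W + \<sigma> X W * \<beta> Y Z) =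
    contract (\<lambda>Y Z. h Y Z * \<epsilon> X W - h Y W * \<epsilon> X Z - h X Z * \<epsilon> Y W + h X W * \<epsilon> Y Z)"
    using assms(3) by (simp add: commutator_identity_def \<epsilon>_def \<sigma>_eq)
  then have "trace_S * \<beta> X W - \<beta> X (S W) - \<beta> (S X) W =
      real DIM('v) * \<epsilon> X W - \<epsilon> X W - \<epsilon> X W"
    by (simp add: contract_linear contract_left contract_right bilinear_linear[OF bil]
        bilinear_linear[OF bil_\<epsilon>] contract_skew[OF bil skew] contract_skew[OF bil_\<epsilon> skew_\<epsilon>]
        contract_h trace_S_def[symmetric])
  then show ?thesis
    by (simp add: \<epsilon>_def algebra_simps)
qed

section \<open>The shape operator when a power of the curvature is nonzero and the next one vanishes\<close>

text \<open>The eigenvalue of \<open>S\<close> on the kernels of the forms below. The denominator \<open>m - 1\<close> is the rank of \<open>S\<close> in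
  the case where \<open>S\<close> is \<open>\<kappa>\<close> times a projection onto a hyperplane.\<close>

definition \<kappa> :: real where "\<kappa> = trace_S / (real DIM('v) - 1)"

definition \<delta> :: "'v \<Rightarrow> 'v \<Rightarrow> real" where "\<delta> X Y = \<sigma> X Y - \<kappa> * h X Y"

lemma \<delta>_bilinear: "bilinear \<delta>" and \<delta>_sym: "\<delta> X Y = \<delta> Y X" and \<delta>_eq: "\<delta> X Y = h (S X - \<kappa> *\<^sub>R X) Y"
proof -
  show "bilinear \<delta>"
    using S_linear by (auto simp: \<delta>_def \<sigma>_def bilinear_def linear_iff h_simps S_simps algebra_simps)
  show "\<delta> X Y = \<delta> Y X"
    by (simp add: \<delta>_def \<sigma>_sym[of X] h_sym[of X])
  show "\<delta> X Y = h (S X - \<kappa> *\<^sub>R X) Y"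
    by (simp add: \<delta>_def h_simps \<sigma>_eq)
qed

context
  fixes \<beta> :: "'v \<Rightarrow> 'v \<Rightarrow> real"
  assumes dim2: "DIM('v) \<ge> 2" and bil: "bilinear \<beta>" and skew: "\<And>X Y. \<beta> Y X = - \<beta> X Y"
    and ci: "commutator_identity \<beta>"
begin

text \<open>The coefficient \<open>\<kappa>\<close> is the same for all \<open>\<beta>\<close>, which makes kernels of different forms comparable.\<close>

lemma derivation_eq: "\<beta> (S X) W + \<beta> X (S W) = \<kappa> * \<beta> X W"
proof -
  have "real DIM('v) - 1 \<noteq> 0" using dim2 by linarith
  then show ?thesis
    using derivation_eq_trace[OF bil skew ci, of X W] by (simp add: \<kappa>_def field_simps)
qed

lemma shifted_identity:
  "\<delta> Y Z * \<beta> X W - \<delta> Y W * \<beta> X Z - \<delta> X Z * \<beta> Y W + \<delta> X W * \<beta> Y Z = 0"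
proof -
  have "\<sigma> Y Z * \<beta> X W - \<sigma> Y W * \<beta> X Z - \<sigma> X Z * \<beta> Y W + \<sigma> X W * \<beta> Y Z =
     h Y Z * (\<kappa> * \<beta> X W) - h Y W * (\<kappa> * \<beta> X Z) - h X Z * (\<kappa> * \<beta> Y W) + h X W * (\<kappa> * \<beta> Y Z)"
    using ci unfolding commutator_identity_def derivation_eq by blast
  then show ?thesis by (simp add: \<delta>_def algebra_simps)
qed

lemma skew_self: "\<beta> X X = 0"
  using skew[of X X] by simp

text \<open>For \<open>X\<close> in the kernel of \<open>\<beta>\<close> the identity \<open>\<delta> \<and> \<beta> = 0\<close> reduces to
  \<open>\<delta>(X,Z) \<beta>(Y,W) = \<delta>(X,W) \<beta>(Y,Z)\<close>. Choosing \<open>Y\<close> with \<open>\<beta>(Y,Z) = 0\<close> but \<open>\<beta>(Y,\<cdot>) \<noteq> 0\<close> gives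
  \<open>\<delta>(X,Z) = 0\<close>; the choice \<open>Y = Z\<close> works unless \<open>Z\<close> is itself in the kernel, when any \<open>Y\<close> outside the
  kernel does.\<close>

lemma kernel_eigenvector:
  assumes nz: "\<beta> U V \<noteq> 0" and X: "\<And>Y. \<beta> X Y = 0"
  shows "S X = \<kappa> *\<^sub>R X"
proof -
  have *: "\<delta> X Z * \<beta> Y W = \<delta> X W * \<beta> Y Z" for Y Z W
    using shifted_identity[of Y Z X W] X by simp
  have "\<delta> X Z = 0" for Z
  proof (cases "\<exists>W. \<beta> Z W \<noteq> 0")
    case True
    then show ?thesis using *[of Z Z] skew_self by auto
  next
    case False
    then show ?thesis using *[of Z U V] nz skew[of U Z] by auto
  qed
  then show ?thesis
    using h_nondegenerate[of "S X - \<kappa> *\<^sub>R X"] by (simp add: \<delta>_eq)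
qed

text \<open>If \<open>\<delta>(Y,Y) \<noteq> 0\<close>, then \<open>\<beta>\<close> is the exterior product of two linear forms, and its kernel contains the
  intersection of the kernels of \<open>\<delta>(\<cdot>,Y)\<close> and \<open>\<beta>(\<cdot>,Y)\<close>.\<close>

lemma skew_form_decomposes:
  "\<delta> Y Y * \<beta> X W = \<delta> W Y * \<beta> X Y - \<delta> X Y * \<beta> W Y"
  using shifted_identity[of Y Y X W] skew[of Y W] \<delta>_sym[of Y W] by (simp add: skew_self)

end

text \<open>If \<open>\<delta>\<close> had no non-isotropic vector, it would vanish by polarization, so that \<open>S = \<kappa>\<close>. Then
  \<open>\<epsilon> = 2\<kappa>\<beta>\<close> and \<open>\<epsilon> = \<kappa>\<beta>\<close> force \<open>\<kappa> = 0\<close> and \<open>S = 0\<close>.\<close>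

lemma shifted_form_nonzero:
  assumes dim2: "DIM('v) \<ge> 2" and bil: "bilinear \<beta>" and skew: "\<And>X Y. \<beta> Y X = - \<beta> X Y"
    and ci: "commutator_identity \<beta>" and nz: "\<beta> U V \<noteq> 0" and S: "S X \<noteq> 0"
  obtains Y where "\<delta> Y Y \<noteq> 0"
proof -
  have "\<exists>Y. \<delta> Y Y \<noteq> 0"
  proof (rule ccontr)
    assume "\<not> ?thesis"
    then have 0: "\<delta> Y Y = 0" for Y by auto
    have "\<delta> Y Z = 0" for Y Z
      using 0[of "Y + Z"] 0[of Y] 0[of Z] \<delta>_sym[of Y Z]
      by (simp add: bilinear_ladd[OF \<delta>_bilinear] bilinear_radd[OF \<delta>_bilinear])
    then have Sc: "S Y = \<kappa> *\<^sub>R Y" for Y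
      using h_nondegenerate[of "S Y - \<kappa> *\<^sub>R Y"] by (simp add: \<delta>_eq)
    have "\<kappa> * \<beta> U V + \<kappa> * \<beta> U V = \<kappa> * \<beta> U V"
      using derivation_eq[OF dim2 bil skew ci, of U V]
      by (simp add: Sc bilinear_lmul[OF bil] bilinear_rmul[OF bil])
    then have "\<kappa> = 0" using nz by simp
    then show False using S Sc[of X] by simp
  qed
  then show ?thesis using that by blast
qed

definition rank_le_1 :: bool where "rank_le_1 \<longleftrightarrow> (\<exists>v. range S \<subseteq> span {v})"

text \<open>The family \<open>\<B>\<close> stands for the forms obtained from one tensor \<open>R \<cdot> T\<close> by all choices of the remaining
  slots. Invariance of \<open>R \<cdot> T\<close> expresses the derivative of \<open>\<beta> \<in> \<B>\<close> along \<open>R(U,V)\<close> as a sum of members of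
  \<open>\<B>\<close>; hence the derivative vanishes wherever all of \<open>\<B>\<close> vanishes.

  Let \<open>K\<close> be the kernel of one nonzero \<open>\<beta>\<close>. If some \<open>\<beta>'\<close> does not vanish on \<open>K\<close>, then \<open>S = \<kappa>\<close> on the sum
  of two different kernels, which contains a hyperplane; the identity \<open>\<epsilon> = \<kappa>\<beta>'\<close> then puts the image of
  \<open>S\<close> into that hyperplane unless \<open>\<kappa> = 0\<close>, when the rank is at most one. Otherwise \<open>K\<close> is invariant under
  every \<open>R(U,V)\<close>, so that it contains the image of \<open>S\<close>; now \<open>\<epsilon> = 0\<close>, hence \<open>\<kappa> = 0\<close> and \<open>S\<^sup>2 = 0\<close>.\<close>

lemma exceptional_shapes:
  fixes \<B> :: "('v \<Rightarrow> 'v \<Rightarrow> real) set"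
  assumes dim: "DIM('v) \<ge> 4" and rank: "\<not> rank_le_1"
    and bil: "\<And>\<beta>. \<beta> \<in> \<B> \<Longrightarrow> bilinear \<beta>" and skew: "\<And>\<beta> X Y. \<beta> \<in> \<B> \<Longrightarrow> \<beta> Y X = - \<beta> X Y"
    and ci: "\<And>\<beta>. \<beta> \<in> \<B> \<Longrightarrow> commutator_identity \<beta>"
    and invariant: "\<And>\<beta> U V X Y. \<beta> \<in> \<B> \<Longrightarrow> (\<forall>\<beta>'\<in>\<B>. \<beta>' X Y = 0) \<Longrightarrow>
        \<beta> (R U V X) Y + \<beta> X (R U V Y) = 0"
    and nz: "\<beta> \<in> \<B>" "\<beta> U0 V0 \<noteq> 0"
  shows "(\<forall>X. S (S X) = 0) \<or>
    (\<kappa> \<noteq> 0 \<and> (\<forall>X. S (S X) = \<kappa> *\<^sub>R S X) \<and> (\<exists>b. \<forall>X. \<exists>t. X = (1 / \<kappa>) *\<^sub>R S X + t *\<^sub>R b))"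
proof -
  have dim2: "DIM('v) \<ge> 2" using dim by simp
  have "\<not> range S \<subseteq> span {0}"
    using rank unfolding rank_le_1_def by blast
  then obtain X1 where "S X1 \<noteq> 0"
    by (auto simp: image_subset_iff)
  then obtain Y0 where Y0: "\<delta> Y0 Y0 \<noteq> 0"
    using shifted_form_nonzero[OF dim2 bil skew ci, OF nz(1) nz(1) nz(1) nz(2)] nz(1) by metis
  have kernel: "(\<forall>W. \<beta>' X W = 0)" if "\<beta>' \<in> \<B>" "\<delta> X Y0 = 0" "\<beta>' X Y0 = 0" for \<beta>' X
    using skew_form_decomposes[OF dim2 bil skew ci, OF that(1) that(1) that(1), of Y0 X] that Y0 by simp
  have eigen: "S X = \<kappa> *\<^sub>R X" if "\<beta>' \<in> \<B>" "\<beta>' X' Y' \<noteq> 0" "\<And>Y. \<beta>' X Y = 0" for \<beta>' X X' Y'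
    using kernel_eigenvector[OF dim2 bil skew ci, OF that(1) that(1) that(1) that(2)] that by blast
  define K where "K = {X. \<forall>W. \<beta> X W = 0}"
  show ?thesis
  proof (cases "\<exists>X0\<in>K. \<exists>\<beta>'\<in>\<B>. \<exists>W. \<beta>' X0 W \<noteq> 0")
    case True
    then obtain X0 \<beta>' W0 where X0: "X0 \<in> K" and \<beta>': "\<beta>' \<in> \<B>" and W0: "\<beta>' X0 W0 \<noteq> 0" by blast
    have SX0: "S X0 = \<kappa> *\<^sub>R X0"
      using eigen[OF nz] X0 by (auto simp: K_def)
    have "\<delta> X0 Y0 = 0"
      by (simp add: \<delta>_eq SX0 h_simps)
    then have d: "\<beta>' X0 Y0 \<noteq> 0"
      using kernel[OF \<beta>', of X0] W0 by blast
    note lin = bilinear_lsub[OF bil[OF \<beta>']] bilinear_lmul[OF bil[OF \<beta>']]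
      bilinear_rmul[OF bil[OF \<beta>']] bilinear_radd[OF bil[OF \<beta>']]
    note \<delta>lin = bilinear_lsub[OF \<delta>_bilinear] bilinear_lmul[OF \<delta>_bilinear]
      bilinear_ladd[OF \<delta>_bilinear]
    have H: "S X = \<kappa> *\<^sub>R X" if "\<delta> X Y0 = 0" for X
    proof -
      \<comment> \<open>subtracting a multiple of the eigenvector \<open>X0\<close> moves \<open>X\<close> into the kernel of \<open>\<beta>'\<close>\<close>
      define X' where "X' = X - (\<beta>' X Y0 / \<beta>' X0 Y0) *\<^sub>R X0"
      have "S X' = \<kappa> *\<^sub>R X'"
        by (rule eigen[OF \<beta>' W0], rule kernel[OF \<beta>', rule_format])
          (simp_all add: X'_def \<delta>lin lin that \<open>\<delta> X0 Y0 = 0\<close> d)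
      then show ?thesis
        by (simp add: X'_def S_simps SX0 algebra_simps)
    qed
    have split: "\<delta> (X - (\<delta> X Y0 / \<delta> Y0 Y0) *\<^sub>R Y0) Y0 = 0" for X
      by (simp add: \<delta>lin Y0)
    have SX: "S X = \<kappa> *\<^sub>R X + (\<delta> X Y0 / \<delta> Y0 Y0) *\<^sub>R (S Y0 - \<kappa> *\<^sub>R Y0)" for X
      using H[OF split[of X]] by (simp add: S_simps algebra_simps)
    show ?thesis
    proof (cases "\<kappa> = 0")
      case True
      have "S X = (\<delta> X Y0 / \<delta> Y0 Y0) *\<^sub>R S Y0" for X
        using SX[of X] True by simp
      then have "range S \<subseteq> span {S Y0}"
        by (metis imageE span_base span_scale insertI1 subsetI)
      then show ?thesis using rank by (auto simp: rank_le_1_def)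
    next
      case False
      \<comment> \<open>on the hyperplane \<open>\<epsilon> = 2 \<kappa> \<beta>'\<close>, whereas \<open>\<epsilon> = \<kappa> \<beta>'\<close> everywhere\<close>
      have van: "\<beta>' X Y = 0" if "\<delta> X Y0 = 0" "\<delta> Y Y0 = 0" for X Y
        using derivation_eq[OF dim2 bil skew ci, OF \<beta>' \<beta>' \<beta>', of X Y] False
        by (simp add: H that lin)
      define u where "u = S Y0 - (\<delta> (S Y0) Y0 / \<delta> Y0 Y0) *\<^sub>R Y0"
      have u: "\<delta> u Y0 = 0" "S Y0 = u + (\<delta> (S Y0) Y0 / \<delta> Y0 Y0) *\<^sub>R Y0"
        using split by (simp_all add: u_def)
      have "\<beta>' X0 (S Y0) = 0"
        using derivation_eq[OF dim2 bil skew ci, OF \<beta>' \<beta>' \<beta>', of X0 Y0]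
        by (simp add: SX0 lin)
      then have "(\<delta> (S Y0) Y0 / \<delta> Y0 Y0) * \<beta>' X0 Y0 = 0"
        using van[OF \<open>\<delta> X0 Y0 = 0\<close> u(1)] by (subst (asm) u(2)) (simp add: lin)
      then have SY0: "\<delta> (S Y0) Y0 = 0"
        using d Y0 by simp
      have im: "\<delta> (S X) Y0 = 0" for X
        by (subst SX[of X]) (simp add: \<delta>lin Y0 SY0)
      have "S (S X) = \<kappa> *\<^sub>R S X" for X
        using H[OF im] .
      moreover have "X = (1 / \<kappa>) *\<^sub>R S X + (\<delta> X Y0 / \<delta> Y0 Y0) *\<^sub>R (Y0 - (1 / \<kappa>) *\<^sub>R S Y0)" for X
        by (subst SX[of X]) (simp add: False algebra_simps)
      ultimately show ?thesis
        using False by blast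
    qed
  next
    case False
    then have all: "\<beta>' X W = 0" if "\<beta>' \<in> \<B>" "X \<in> K" for \<beta>' X W
      using that by blast
    note lin = bilinear_lsub[OF bil[OF nz(1)]] bilinear_lmul[OF bil[OF nz(1)]]
      bilinear_rmul[OF bil[OF nz(1)]]
    have inv: "\<beta> (R U V X) Y = 0" if "X \<in> K" for X Y U V
      using invariant[OF nz(1), of X Y U V] all[OF _ that] all[OF nz(1) that, of "R U V Y"] by auto
    have imS: "\<beta> (S U) Y = 0" for U Y
    proof -
      \<comment> \<open>three linear conditions in dimension at least four; they make \<open>R U V X\<close> a multiple of \<open>S U\<close>\<close>
      obtain X where X: "X \<noteq> 0" "\<delta> X Y0 = 0" "\<beta> X Y0 = 0" "h U X = 0"
      proof -
        define f where "f i X = (if i = 0 then \<delta> X Y0 else if i = 1 then \<beta> X Y0 else h U X)"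
          for i :: nat and X
        have "linear (f i)" for i
          using bil[OF nz(1)] \<delta>_bilinear h_bilinear
          by (cases "i = 0"; cases "i = 1") (auto simp: f_def[abs_def] bilinear_def)
        then obtain X where "X \<noteq> 0" "\<And>i. i \<in> {0, 1, 2} \<Longrightarrow> f i X = 0"
          using common_kernel_nontrivial[of "{0, 1, 2}" f] dim by auto
        from this(1) this(2)[of 0] this(2)[of 1] this(2)[of 2] show ?thesis
          using that by (simp add: f_def)
      qed
      then have "X \<in> K"
        using kernel[OF nz(1) X(2,3)] by (simp add: K_def)
      obtain V where "h X V \<noteq> 0"
        using h_nondegenerate[of X] X(1) by blast
      then show ?thesis
        using inv[OF \<open>X \<in> K\<close>, of U V Y] X(4) by (simp add: R_def lin h_sym[of V])
    qed
    have "\<kappa> * \<beta> U0 V0 = 0"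
      using derivation_eq[OF dim2 bil skew ci, OF nz(1) nz(1) nz(1), of U0 V0] imS
        skew[OF nz(1), of U0 "S V0"] by simp
    then have "\<kappa> = 0" using nz by simp
    have "S (S X) = 0" for X
      using eigen[OF nz, of "S X"] imS \<open>\<kappa> = 0\<close> by simp
    then show ?thesis by blast
  qed
qed

section \<open>Descent to the first power\<close>

text \<open>Contracting \<open>\<omega>(R(X,Y)Z,W) + \<omega>(Z,R(X,Y)W) = 0\<close> in \<open>Y\<close> and \<open>Z\<close> gives
  \<open>(m - 2) \<omega>(SX,W) = t h(X,W)\<close> with a constant \<open>t\<close>. For \<open>W = SX\<close> the left side vanishes, so either
  \<open>t = 0\<close> and \<open>SX\<close> is in the kernel of \<open>\<omega>\<close>, or \<open>h(X,SX) = 0\<close> for all \<open>X\<close> and \<open>S = 0\<close> by polarization.\<close>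

lemma annihilated_form_imp_S_zero:
  fixes \<omega> :: "'v \<Rightarrow> 'v \<Rightarrow> real"
  assumes dim: "DIM('v) \<ge> 4" and bil: "bilinear \<omega>" and skew: "\<And>X Y. \<omega> Y X = - \<omega> X Y"
    and nondeg: "\<And>u. (\<And>v. \<omega> u v = 0) \<Longrightarrow> u = 0"
    and ann: "\<And>X Y Z W. \<omega> (R X Y Z) W + \<omega> Z (R X Y W) = 0"
  shows "S X = 0"
proof -
  define t where "t = contract (\<lambda>Y Z. \<omega> Z (S Y))"
  have key: "(real DIM('v) - 2) * \<omega> (S X) W = t * h X W" for X W
  proof -
    have "h Y Z * \<omega> (S X) W - h X Z * \<omega> (S Y) W + h Y W * \<omega> Z (S X) - h X W * \<omega> Z (S Y) = 0" for Y Z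
      using ann[of X Y Z W]
      by (simp add: R_def bilinear_lsub[OF bil] bilinear_rsub[OF bil] bilinear_lmul[OF bil] bilinear_rmul[OF bil])
    then have "contract (\<lambda>Y Z. h Y Z * \<omega> (S X) W - h X Z * \<omega> (S Y) W + h Y W * \<omega> Z (S X)
        - h X W * \<omega> Z (S Y)) = 0"
      by (simp add: contract_def)
    then have "real DIM('v) * \<omega> (S X) W - \<omega> (S X) W + \<omega> W (S X) - h X W * t = 0"
      by (simp add: contract_linear contract_left contract_right bilinear_linear[OF bil] contract_h t_def)
    then show ?thesis
      using skew[of "S X" W] by (simp add: algebra_simps)
  qed
  have S0: "S X = 0" if "t = 0" for X
    using key[of X] nondeg[of "S X"] dim that by auto
  have "S X = 0" if "t \<noteq> 0" for X
  proof -
    have "\<omega> (S X) (S X) = 0" for X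
      using skew[of "S X" "S X"] by simp
    then have 0: "\<sigma> X X = 0" for X
      using key[of X "S X"] that by (simp add: \<sigma>_eq)
    have "\<sigma> X Y = 0" for Y
      using 0[of "X + Y"] 0[of X] 0[of Y] \<sigma>_sym[of X Y]
      by (simp add: \<sigma>_def S_simps h_simps)
    then show ?thesis
      using h_nondegenerate[of "S X"] by (simp add: \<sigma>_eq)
  qed
  then show ?thesis using S0 by blast
qed

text \<open>The contraction of \<open>h \<and> \<beta> = 0\<close> over the image of \<open>S\<close> only. Since \<open>S\<^sup>2 = \<kappa>S\<close>, the vectors \<open>S e\<close> and
  \<open>S (sharp e)\<close> are, up to the factor \<open>\<kappa>\<^sup>2\<close>, dual frames of that hyperplane, whose dimension \<open>m - 1\<close> enters
  through the trace. The contraction yields \<open>\<kappa>\<^sup>2(m - 3)\<beta> = 0\<close>.\<close>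

lemma curvature_identity_contracts:
  fixes \<beta> :: "'v \<Rightarrow> 'v \<Rightarrow> real"
  assumes bil: "bilinear \<beta>" and skew: "\<And>X Y. \<beta> Y X = - \<beta> X Y"
    and \<kappa>: "\<kappa> \<noteq> 0" and SS: "\<And>X. S (S X) = \<kappa> *\<^sub>R S X" and dim: "DIM('v) \<ge> 4"
    and id: "\<And>X Y Z W. X \<in> range S \<Longrightarrow> Y \<in> range S \<Longrightarrow> Z \<in> range S \<Longrightarrow> W \<in> range S \<Longrightarrow>
       h Y Z * \<beta> X W - h Y W * \<beta> X Z - h X Z * \<beta> Y W + h X W * \<beta> Y Z = 0"
    and XW: "X \<in> range S" "W \<in> range S"
  shows "\<beta> X W = 0"
proof -
  have range_eigen: "S V = \<kappa> *\<^sub>R V" if "V \<in> range S" for V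
    using that SS by auto
  have SSi: "h (S Y) (S Z) = \<kappa> * \<sigma> Y Z" for Y Z
    by (simp add: \<sigma>_def S_selfadjoint SS h_simps)
  have "(\<kappa> * \<sigma> Y Z) * \<beta> X W - h (S Y) W * \<beta> X (S Z) - h X (S Z) * \<beta> (S Y) W
      + h X W * \<beta> (S Y) (S Z) = 0" for Y Z
    using id[OF XW(1) rangeI rangeI XW(2), of Y Z] by (simp only: SSi)
  then have "contract (\<lambda>Y Z. (\<kappa> * \<sigma> Y Z) * \<beta> X W - h Y (S W) * \<beta> X (S Z) - h (S X) Z * \<beta> (S Y) W
      + h X W * \<beta> (S Y) (S Z)) = 0"
    by (simp add: contract_def S_selfadjoint)
  moreover have "contract (\<lambda>Y Z. \<beta> (S Y) (S Z)) = 0"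
    by (rule contract_skew[OF bilinear_S(3)[OF bil]]) (rule skew)
  ultimately have "\<kappa> * trace_S * \<beta> X W - \<beta> X (S (S W)) - \<beta> (S (S X)) W = 0"
    by (simp add: contract_linear contract_left contract_right bilinear_linear[OF bil] trace_S_def[symmetric])
  moreover have "S (S W) = \<kappa>\<^sup>2 *\<^sub>R W" "S (S X) = \<kappa>\<^sup>2 *\<^sub>R X"
    by (simp_all add: range_eigen[OF XW(1)] range_eigen[OF XW(2)] S_simps power2_eq_square)
  moreover have "trace_S = \<kappa> * (real DIM('v) - 1)"
    using dim by (simp add: \<kappa>_def)
  ultimately have "\<kappa>\<^sup>2 * (real DIM('v) - 3) * \<beta> X W = 0"
    by (simp add: bilinear_lmul[OF bil] bilinear_rmul[OF bil] algebra_simps power2_eq_square)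
  then show ?thesis using \<kappa> dim by simp
qed

text \<open>On the image of \<open>S\<close> one has \<open>\<sigma> = \<kappa>h\<close> and \<open>\<epsilon> = 2\<kappa>\<beta>\<close>, so the relation from \<open>second_action_relation\<close>
  becomes \<open>h \<and> \<beta> = 0\<close>; the equation \<open>R \<cdot> \<omega> = 0\<close> takes the same form with \<open>\<omega>\<close> for \<open>\<beta>\<close>. Each step
  therefore lowers the exponent by one, with all arguments kept in the image of \<open>S\<close>.\<close>

lemma projection_case:
  fixes \<omega> :: "'v \<Rightarrow> 'v \<Rightarrow> real"
  assumes \<kappa>: "\<kappa> \<noteq> 0" and SS: "\<And>X. S (S X) = \<kappa> *\<^sub>R S X" and dim: "DIM('v) \<ge> 4"
    and bil: "bilinear \<omega>" and skew: "\<And>X Y. \<omega> Y X = - \<omega> X Y"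
    and van: "\<And>Xs. length Xs = 2 * k + 2 \<Longrightarrow> set Xs \<subseteq> range S \<Longrightarrow>
        Rpow k (\<lambda>L. \<omega> (L ! 0) (L ! 1)) Xs = 0"
    and XY: "X \<in> range S" "Y \<in> range S"
  shows "\<omega> X Y = 0"
  using van
proof (induction k)
  case 0
  then show ?case using XY by (force dest: spec[of _ "[X, Y]"])
next
  case (Suc k)
  let ?\<omega> = "\<lambda>L. \<omega> (L ! 0) (L ! 1)"
  have range_eigen: "S V = \<kappa> *\<^sub>R V" if "V \<in> range S" for V
    using that SS by auto
  have M: "multilinear_on_lists (2 * j + 2) (Rpow j ?\<omega>)" for j
    by (rule multilinear_Rpow[OF multilinear_form[OF bil]])
  show ?case
  proof (rule Suc.IH)
    fix Xs :: "'v list"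
    assume len: "length Xs = 2 * k + 2" and ran: "set Xs \<subseteq> range S"
    then obtain U V L where Xs: "Xs = U # V # L" and L: "length L = 2 * k"
      by (cases Xs; cases "tl Xs") auto
    have UV: "U \<in> range S" "V \<in> range S" and Lran: "set L \<subseteq> range S"
      using ran by (auto simp: Xs)
    show "Rpow k ?\<omega> Xs = 0"
    proof (cases k)
      case 0
      have "\<omega> U V = 0"
      proof (rule curvature_identity_contracts[OF bil skew \<kappa> SS dim _ UV])
        fix X Y Z W
        assume *: "X \<in> range S" "Y \<in> range S" "Z \<in> range S" "W \<in> range S"
        have "tensor_action R ?\<omega> [X, Y, Z, W] = 0"
          using Suc.prems[of "[X, Y, Z, W]"] * by (simp add: 0)
        then have "\<kappa> * (h Y Z * \<omega> X W - h Y W * \<omega> X Z - h X Z * \<omega> Y W + h X W * \<omega> Y Z) = 0"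
          by (simp add: lessThan_Suc numeral_2_eq_2 R_def bilinear_lsub[OF bil] bilinear_rsub[OF bil] bilinear_lmul[OF bil]
              bilinear_rmul[OF bil] range_eigen[OF *(1)] range_eigen[OF *(2)] skew[of Z X] skew[of Z Y] algebra_simps)
        then show "h Y Z * \<omega> X W - h Y W * \<omega> X Z - h X Z * \<omega> Y W + h X W * \<omega> Y Z = 0"
          using \<kappa> by simp
      qed
      then show ?thesis using L by (simp add: Xs 0)
    next
      case (Suc j)
      define \<beta> where "\<beta> U V = tensor_action R (Rpow j ?\<omega>) (U # V # L)" for U V
      have Lj: "length L = 2 * j + 2" using L Suc by simp
      note MT = M[of j, folded Lj]
      have bil\<beta>: "bilinear \<beta>" and skew\<beta>: "\<beta> B A = - \<beta> A B" for A B
        unfolding \<beta>_def by (rule tensor_action_R_bilinear[OF MT])+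
      have "\<beta> U V = 0"
      proof (rule curvature_identity_contracts[OF bil\<beta> skew\<beta> \<kappa> SS dim _ UV])
        fix X Y Z W
        assume *: "X \<in> range S" "Y \<in> range S" "Z \<in> range S" "W \<in> range S"
        have z: "tensor_action R (tensor_action R (Rpow j ?\<omega>)) (A # B # C # D # L) = 0"
          if "{A, B, C, D} \<subseteq> range S" for A B C D
          using Suc.prems[of "A # B # C # D # L"] that Lran Lj by (simp add: Suc del: tensor_action_Cons2)
        have \<sigma>\<kappa>: "\<sigma> A B = \<kappa> * h A B" if "A \<in> range S" for A B
          using range_eigen[OF that] by (simp add: \<sigma>_def h_simps)
        have "\<kappa> * (h Y Z * \<beta> X W - h Y W * \<beta> X Z - h X Z * \<beta> Y W + h X W * \<beta> Y Z) = 0"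
          using second_action_relation[OF MT z z, of X Y Z W, folded \<beta>_def] *
          by (simp add: \<sigma>\<kappa>[OF *(1)] \<sigma>\<kappa>[OF *(2)] range_eigen[OF *(1)] range_eigen[OF *(2)] range_eigen[OF *(3)] range_eigen[OF *(4)] bilinear_lmul[OF bil\<beta>] bilinear_rmul[OF bil\<beta>] algebra_simps)
        then show "h Y Z * \<beta> X W - h Y W * \<beta> X Z - h X Z * \<beta> Y W + h X W * \<beta> Y Z = 0"
          using \<kappa> by simp
      qed
      then show ?thesis by (simp add: Xs Suc \<beta>_def del: tensor_action_Cons2)
    qed
  qed
qed

text \<open>\<open>\<omega>\<close> vanishes on the image of \<open>S\<close>, and one vector \<open>b\<close> spans a complement, so \<open>SX \<mapsto> \<omega>(SX,b)\<close> is injective.\<close>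

lemma projection_case_impossible:
  fixes \<omega> :: "'v \<Rightarrow> 'v \<Rightarrow> real"
  assumes \<kappa>: "\<kappa> \<noteq> 0" and SS: "\<And>X. S (S X) = \<kappa> *\<^sub>R S X" and dim: "DIM('v) \<ge> 4"
    and split: "\<And>X. \<exists>t. X = (1 / \<kappa>) *\<^sub>R S X + t *\<^sub>R b"
    and bil: "bilinear \<omega>" and skew: "\<And>X Y. \<omega> Y X = - \<omega> X Y"
    and nondeg: "\<And>u. (\<And>v. \<omega> u v = 0) \<Longrightarrow> u = 0"
    and van: "\<And>Xs. length Xs = 2 * k + 2 \<Longrightarrow> Rpow k (\<lambda>L. \<omega> (L ! 0) (L ! 1)) Xs = 0"
  shows "rank_le_1"
proof -
  have 0: "\<omega> (S X) (S Y) = 0" for X Y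
    by (rule projection_case[OF \<kappa> SS dim bil skew]) (use van in auto)
  have zero: "S X = 0" if "\<omega> (S X) b = 0" for X
  proof (rule nondeg)
    fix v
    obtain t where "v = (1 / \<kappa>) *\<^sub>R S v + t *\<^sub>R b" using split by blast
    then have "\<omega> (S X) v = \<omega> (S X) ((1 / \<kappa>) *\<^sub>R S v + t *\<^sub>R b)" by simp
    then show "\<omega> (S X) v = 0"
      by (simp add: 0 that bilinear_radd[OF bil] bilinear_rmul[OF bil])
  qed
  show ?thesis
  proof (cases "\<forall>X. S X = 0")
    case True
    then show ?thesis unfolding rank_le_1_def by (auto intro!: exI[of _ 0])
  next
    case False
    then obtain X where X: "\<omega> (S X) b \<noteq> 0" using zero by blast
    have "S Y = (\<omega> (S Y) b / \<omega> (S X) b) *\<^sub>R S X" for Y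
      using zero[of "Y - (\<omega> (S Y) b / \<omega> (S X) b) *\<^sub>R X"] X
      by (simp add: S_simps bilinear_lsub[OF bil] bilinear_lmul[OF bil])
    then have "range S \<subseteq> span {S X}"
      by (metis imageE span_base span_scale insertI1 subsetI)
    then show ?thesis unfolding rank_le_1_def by blast
  qed
qed

text \<open>All correction terms vanish because \<open>R(X,Y)\<close> kills the entries \<open>X\<close>, \<open>Y\<close> and \<open>W\<close>; each factor acts only on
  \<open>Z\<close>.\<close>

lemma Rpow_repeated_pair:
  fixes \<omega> :: "'v \<Rightarrow> 'v \<Rightarrow> real"
  assumes bil: "bilinear \<omega>" and kill: "R X Y X = 0" "R X Y Y = 0" "R X Y W = 0"
  shows "Rpow k (\<lambda>L. \<omega> (L ! 0) (L ! 1)) (concat (replicate k [X, Y]) @ [Z, W]) =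
    (-1) ^ k * \<omega> ((R X Y ^^ k) Z) W"
proof (induction k arbitrary: Z)
  case 0
  then show ?case by simp
next
  case (Suc k)
  define T where "T = Rpow k (\<lambda>L. \<omega> (L ! 0) (L ! 1))"
  define L where "L = concat (replicate k [X, Y]) @ [Z, W]"
  have len: "length (concat (replicate k [X, Y])) = 2 * k"
    by (induction k) auto
  have M: "multilinear_on_lists (2 * k + 2) T"
    unfolding T_def by (rule multilinear_Rpow[OF multilinear_form[OF bil]])
  have "T (L[i := R X Y (L ! i)]) = 0" if "i < length L" "i \<noteq> 2 * k" for i
  proof -
    have "R X Y (L ! i) = 0"
    proof (cases "i < 2 * k")
      case True
      then have "L ! i \<in> set (concat (replicate k [X, Y]))"
        unfolding L_def nth_append len by (simp add: len del: set_concat)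
      then have "L ! i \<in> {X, Y}"
        by (auto simp: set_replicate_conv_if split: if_splits)
      then show ?thesis using kill by auto
    next
      case False
      then have "i = Suc (2 * k)" using that by (simp add: L_def len)
      then show ?thesis using kill by (simp add: L_def nth_append len)
    qed
    then show ?thesis
      using multilinear_on_lists_zero[OF M, of L i] that by (simp add: L_def len)
  qed
  then have "(\<Sum>i<length L. T (L[i := R X Y (L ! i)])) = T (L[2 * k := R X Y (L ! (2 * k))])"
    by (subst sum.remove[of _ "2 * k"]) (auto simp: L_def len)
  also have "L[2 * k := R X Y (L ! (2 * k))] = concat (replicate k [X, Y]) @ [R X Y Z, W]"
    by (simp add: L_def nth_append list_update_append len)
  finally have "tensor_action R T (X # Y # L) = - T (concat (replicate k [X, Y]) @ [R X Y Z, W])"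
    by simp
  then have "tensor_action R T (X # Y # L) = (-1) ^ Suc k * \<omega> ((R X Y ^^ Suc k) Z) W"
    using Suc.IH[of "R X Y Z", folded T_def] by (simp add: funpow_swap1 del: tensor_action_Cons2)
  then show ?case
    by (simp add: T_def L_def del: tensor_action_Cons2)
qed

text \<open>Since \<open>S\<^sup>2 = 0\<close>, adding an element of the image of \<open>S\<close> to a vector changes no value of \<open>\<sigma>\<close>, but it does
  change \<open>h\<close>. Vectors \<open>A, B\<close> that are \<open>\<sigma>\<close>-orthogonal and not \<open>\<sigma>\<close>-isotropic can therefore be modified to
  \<open>X, Y\<close> spanning an \<open>h\<close>-isotropic plane. The operator \<open>R(X,Y)\<close> exchanges the lines of \<open>SX\<close> and \<open>SY\<close>,
  so \<open>\<omega>(SX,W) = 0\<close> for all \<open>W\<close> orthogonal to \<open>X\<close> and \<open>Y\<close>. These \<open>W\<close> together with \<open>SX, SY\<close> span the space,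
  and \<open>\<omega>(SX,SY) = 0\<close> follows by applying the same to the isotropic plane of \<open>X + SY\<close>.\<close>

lemma nilpotent_case_impossible:
  fixes \<omega> :: "'v \<Rightarrow> 'v \<Rightarrow> real"
  assumes SS: "\<And>X. S (S X) = 0"
    and bil: "bilinear \<omega>" and skew: "\<And>X Y. \<omega> Y X = - \<omega> X Y"
    and nondeg: "\<And>u. (\<And>v. \<omega> u v = 0) \<Longrightarrow> u = 0"
    and van: "\<And>Xs. length Xs = 2 * k + 2 \<Longrightarrow> Rpow k (\<lambda>L. \<omega> (L ! 0) (L ! 1)) Xs = 0"
  shows "rank_le_1"
proof (rule ccontr)
  assume rank: "\<not> rank_le_1"
  have \<sigma>lin: "\<sigma> (X + X') Y = \<sigma> X Y + \<sigma> X' Y" "\<sigma> (X - X') Y = \<sigma> X Y - \<sigma> X' Y"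
      "\<sigma> (a *\<^sub>R X) Y = a * \<sigma> X Y" "\<sigma> X (Y + Y') = \<sigma> X Y + \<sigma> X Y'"
      "\<sigma> X (Y - Y') = \<sigma> X Y - \<sigma> X Y'" "\<sigma> X (a *\<^sub>R Y) = a * \<sigma> X Y"
      for X X' Y Y' a
    by (simp_all add: \<sigma>_def S_simps h_simps)
  have S0: "\<sigma> X (S Y) = 0" "\<sigma> (S X) Y = 0" for X Y
    by (simp_all add: \<sigma>_def S_selfadjoint SS h_simps)
  have isotropic: "\<exists>Y. \<sigma> X Y \<noteq> 0" if "S X \<noteq> 0" for X
    using h_nondegenerate[of "S X"] that by (auto simp: \<sigma>_def)
  have polar: "\<exists>Z\<in>{X, Y, X + Y}. \<sigma> Z Z \<noteq> 0" if "\<sigma> X Y \<noteq> 0" for X Y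
    using that \<sigma>_sym[of X Y] by (auto simp: \<sigma>lin)
  have "\<not> range S \<subseteq> span {0}"
    using rank unfolding rank_le_1_def by blast
  then obtain X1 where "S X1 \<noteq> 0"
    by (auto simp: image_subset_iff)
  then obtain A where A: "\<sigma> A A \<noteq> 0"
    using isotropic polar by meson
  have "\<exists>Y. S (Y - (\<sigma> Y A / \<sigma> A A) *\<^sub>R A) \<noteq> 0"
  proof (rule ccontr)
    assume "\<not> ?thesis"
    then have "S (Y - (\<sigma> Y A / \<sigma> A A) *\<^sub>R A) = 0" for Y
      by blast
    then have "S Y = (\<sigma> Y A / \<sigma> A A) *\<^sub>R S A" for Y
      unfolding S_simps right_minus_eq .
    then have "range S \<subseteq> span {S A}"
      by (metis imageE span_base span_scale insertI1 subsetI)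
    then show False using rank unfolding rank_le_1_def by blast
  qed
  then obtain Y where "S (Y - (\<sigma> Y A / \<sigma> A A) *\<^sub>R A) \<noteq> 0" by blast
  moreover have "\<sigma> (Y - (\<sigma> Y A / \<sigma> A A) *\<^sub>R A) A = 0"
    using A by (simp add: \<sigma>lin)
  ultimately obtain Y1 where Y1: "S Y1 \<noteq> 0" "\<sigma> Y1 A = 0" by blast
  obtain Y2 where Y2: "\<sigma> Y1 Y2 \<noteq> 0" using isotropic[OF Y1(1)] by blast
  have "\<sigma> Y1 (Y2 - (\<sigma> Y2 A / \<sigma> A A) *\<^sub>R A) \<noteq> 0" "\<sigma> (Y2 - (\<sigma> Y2 A / \<sigma> A A) *\<^sub>R A) A = 0"
    using Y1 Y2 A by (simp_all add: \<sigma>lin)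
  then obtain Y3 where "\<sigma> Y1 Y3 \<noteq> 0" "\<sigma> Y3 A = 0" by blast
  then obtain B where B: "\<sigma> B B \<noteq> 0" "\<sigma> B A = 0"
    using polar[of Y1 Y3] Y1(2) \<sigma>lin(1)[of Y1 Y3 A] by auto
  have AB: "\<sigma> A B = 0" using B(2) \<sigma>_sym by metis
  have van2: "\<omega> (S X) W = 0"
    if iso: "h X X = 0" "h X Y = 0" "h Y Y = 0" and gram: "\<sigma> X X \<noteq> 0" "\<sigma> X Y = 0" "\<sigma> Y Y \<noteq> 0"
      and W: "h X W = 0" "h Y W = 0" for X Y W
  proof -
    have kill: "R X Y X = 0" "R X Y Y = 0" "R X Y W = 0"
      using iso W by (simp_all add: R_def h_sym[of Y X])
    have pow: "\<exists>a\<noteq>0. (R X Y ^^ j) (S X) = a *\<^sub>R S X \<or> (R X Y ^^ j) (S X) = a *\<^sub>R S Y" for j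
    proof (induction j)
      case 0
      then show ?case by (intro exI[of _ 1]) simp
    next
      case (Suc j)
      then obtain a where a: "a \<noteq> 0"
        "(R X Y ^^ j) (S X) = a *\<^sub>R S X \<or> (R X Y ^^ j) (S X) = a *\<^sub>R S Y" by blast
      have 1: "R X Y (a *\<^sub>R S X) = (- a * \<sigma> X X) *\<^sub>R S Y" "R X Y (a *\<^sub>R S Y) = (a * \<sigma> Y Y) *\<^sub>R S X"
        using gram by (simp_all add: R_def h_simps \<sigma>_eq \<sigma>_sym[of Y X])
      then show ?case
        using a gram
        by (auto intro: exI[of _ "- a * \<sigma> X X"] exI[of _ "a * \<sigma> Y Y"])
    qed
    have len: "length (concat (replicate k [X, Y])) = 2 * k"
      by (induction k) auto
    have zk: "\<omega> ((R X Y ^^ k) Z) W = 0" for Z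
      using Rpow_repeated_pair[OF bil kill, of k Z] van[of "concat (replicate k [X, Y]) @ [Z, W]"]
      by (simp add: len)
    have "\<omega> ((R X Y ^^ k) (S X)) W = 0" "\<omega> (R X Y ((R X Y ^^ k) (S X))) W = 0"
      using zk[of "S X"] zk[of "R X Y (S X)"] by (simp_all add: funpow_swap1)
    moreover obtain a where "a \<noteq> 0"
      "(R X Y ^^ k) (S X) = a *\<^sub>R S X \<or> (R X Y ^^ k) (S X) = a *\<^sub>R S Y" using pow by blast
    ultimately show ?thesis
      using gram by (auto simp: R_def h_simps \<sigma>_eq \<sigma>_sym[of Y X]
          bilinear_lmul[OF bil])
  qed
  \<comment> \<open>the coefficients solve \<open>h(X,X) = h(X,Y) = h(Y,Y) = 0\<close>, which is linear in them as \<open>S\<^sup>2 = 0\<close>\<close>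
  define X where "X = A - (h A A / (2 * \<sigma> A A)) *\<^sub>R S A"
  define Y where "Y = B - (h A B / \<sigma> A A) *\<^sub>R S A - (h B B / (2 * \<sigma> B B)) *\<^sub>R S B"
  have SX: "S X = S A" and SY: "S Y = S B"
    by (simp_all add: X_def Y_def S_simps SS)
  have hS: "h U (S V) = \<sigma> U V" "h (S U) V = \<sigma> U V" for U V by (simp_all add: \<sigma>_eq)
  have gram: "\<sigma> X X = \<sigma> A A" "\<sigma> X Y = 0" "\<sigma> Y Y = \<sigma> B B" "\<sigma> Y X = 0"
    by (simp_all add: X_def Y_def \<sigma>lin S0 AB B)
  have iso: "h X X = 0" "h X Y = 0" "h Y Y = 0"
    using A B AB by (simp_all add: X_def Y_def h_simps hS \<sigma>lin S0 h_sym[of B A] field_simps)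
  \<comment> \<open>a second isotropic plane with the same image under \<open>S\<close>; the correction of \<open>Y\<close> restores orthogonality to \<open>X + SY\<close>\<close>
  have iso': "h (X + S Y) (X + S Y) = 0"
      "h (X + S Y) (Y - (\<sigma> B B / \<sigma> A A) *\<^sub>R S X) = 0"
      "h (Y - (\<sigma> B B / \<sigma> A A) *\<^sub>R S X) (Y - (\<sigma> B B / \<sigma> A A) *\<^sub>R S X) = 0"
    using A by (simp_all add: h_simps hS \<sigma>lin S0 iso gram h_sym[of Y X])
  have gram': "\<sigma> (X + S Y) (X + S Y) \<noteq> 0" "\<sigma> (X + S Y) (Y - (\<sigma> B B / \<sigma> A A) *\<^sub>R S X) = 0"
      "\<sigma> (Y - (\<sigma> B B / \<sigma> A A) *\<^sub>R S X) (Y - (\<sigma> B B / \<sigma> A A) *\<^sub>R S X) \<noteq> 0"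
    using A B by (simp_all add: \<sigma>lin S0 gram)
  have "\<omega> (S (X + S Y)) (X + S Y) = 0"
    by (rule van2[OF iso' gram' iso'(1)], subst h_sym, rule iso'(2))
  moreover have "\<omega> (S X) X = 0"
    by (rule van2[OF iso]) (use iso A B in \<open>simp_all add: gram h_sym[of Y X]\<close>)
  ultimately have XY: "\<omega> (S X) (S Y) = 0"
    by (simp add: S_simps SS bilinear_radd[OF bil])
  have "\<omega> (S X) W = 0" for W
  proof -
    define W' where "W' = W - (h X W / \<sigma> X X) *\<^sub>R S X - (h Y W / \<sigma> Y Y) *\<^sub>R S Y"
    have "\<omega> (S X) W' = 0"
      by (rule van2[OF iso]) (use A B in \<open>simp_all add: gram W'_def h_simps hS\<close>)
    then show ?thesis
      using XY skew[of "S X" "S X"]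
      by (simp add: W'_def bilinear_rsub[OF bil] bilinear_rmul[OF bil])
  qed
  then have "S X = 0" by (rule nondeg)
  then show False using gram(1) A by (simp add: \<sigma>_def h_simps)
qed

text \<open>\<open>R \<cdot> (R \<cdot> T) = 0\<close> says that \<open>R \<cdot> T\<close> is invariant under \<open>R(U,V)\<close>; here the slots \<open>X\<close>, \<open>Y\<close> are separated
  from the others.\<close>

lemma Rpow_equivariant:
  assumes "multilinear_on_lists (length L) T" "tensor_action R (tensor_action R T) (U # V # X # Y # L) = 0"
  shows "tensor_action R T (R U V X # Y # L) + tensor_action R T (X # R U V Y # L) =
    - (\<Sum>i<length L. tensor_action R T (X # Y # L[i := R U V (L ! i)]))"
proof -
  have "(\<Sum>i<Suc (Suc (length L)). tensor_action R T ((X # Y # L)[i := R U V ((X # Y # L) ! i)])) = 0"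
    using assms(2) by (subst (asm) tensor_action_Cons2) simp
  then show ?thesis
    by (simp only: sum.lessThan_Suc_shift) simp
qed

text \<open>Induction on the exponent: either the previous power vanishes as well, or its slots provide a nonzero
  family for \<open>exceptional_shapes\<close>.\<close>

theorem vanishing_curvature_power_imp_rank:
  fixes \<omega> :: "'v \<Rightarrow> 'v \<Rightarrow> real"
  assumes dim: "DIM('v) \<ge> 4" and bil: "bilinear \<omega>" and skew: "\<And>X Y. \<omega> Y X = - \<omega> X Y"
    and nondeg: "\<And>u. (\<And>v. \<omega> u v = 0) \<Longrightarrow> u = 0"
    and k: "k \<ge> 1"
    and van: "\<And>Xs. length Xs = 2 * k + 2 \<Longrightarrow> Rpow k (\<lambda>L. \<omega> (L ! 0) (L ! 1)) Xs = 0"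
  shows "rank_le_1"
  using k van
proof (induction k rule: nat_induct_at_least)
  case base
  let ?\<omega> = "\<lambda>L. \<omega> (L ! 0) (L ! 1)"
  have "\<omega> (R X Y Z) W + \<omega> Z (R X Y W) = 0" for X Y Z W
    using base[of "[X, Y, Z, W]"] by (simp add: lessThan_Suc numeral_2_eq_2)
  from annihilated_form_imp_S_zero[OF dim bil skew nondeg this] show ?case
    unfolding rank_le_1_def by (auto intro!: exI[of _ 0])
next
  case (Suc k)
  let ?\<omega> = "\<lambda>L. \<omega> (L ! 0) (L ! 1)"
  show ?case
  proof (cases "\<forall>Xs. length Xs = 2 * k + 2 \<longrightarrow> Rpow k ?\<omega> Xs = 0")
    case True
    then show ?thesis using Suc.IH by blast
  next
    case False
    then obtain Xs where len: "length Xs = 2 * k + 2" and nz: "Rpow k ?\<omega> Xs \<noteq> 0" by blast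
    obtain j where j: "k = Suc j" using Suc.hyps by (cases k) auto
    define T where "T = Rpow j ?\<omega>"
    define \<B> where "\<B> = {\<lambda>X Y. tensor_action R T (X # Y # L) | L. length L = 2 * j + 2}"
    have M: "multilinear_on_lists (length L) T" if "length L = 2 * j + 2" for L :: "'v list"
      using multilinear_Rpow[OF multilinear_form[OF bil], of j] that by (simp add: T_def)
    have z: "tensor_action R (tensor_action R T) (X # Y # Z # W # L) = 0"
      if "length L = 2 * j + 2" for X Y Z W L
      using Suc.prems[of "X # Y # Z # W # L"] that
      by (simp add: j T_def del: tensor_action_Cons2)
    show ?thesis
    proof (rule ccontr)
      assume rank: "\<not> rank_le_1"
      obtain U V L where Xs: "Xs = U # V # L" and L: "length L = 2 * j + 2"
        using len j by (cases Xs; cases "tl Xs") auto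
      have "(\<forall>X. S (S X) = 0) \<or>
        (\<kappa> \<noteq> 0 \<and> (\<forall>X. S (S X) = \<kappa> *\<^sub>R S X) \<and> (\<exists>b. \<forall>X. \<exists>t. X = (1 / \<kappa>) *\<^sub>R S X + t *\<^sub>R b))"
      proof (rule exceptional_shapes[OF dim rank, of \<B> "\<lambda>X Y. tensor_action R T (X # Y # L)" U V])
        show "bilinear \<beta>" if "\<beta> \<in> \<B>" for \<beta>
          using that tensor_action_R_bilinear(1)[OF M] by (auto simp: \<B>_def simp del: tensor_action_Cons2)
        show "\<beta> Y X = - \<beta> X Y" if "\<beta> \<in> \<B>" for \<beta> X Y
          using that tensor_action_R_bilinear(2)[OF M] by (auto simp: \<B>_def simp del: tensor_action_Cons2)
        show "commutator_identity \<beta>" if "\<beta> \<in> \<B>" for \<beta>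
          using that second_action_relation[OF M z z]
          by (auto simp: \<B>_def commutator_identity_def simp del: tensor_action_Cons2)
        show "\<beta> (R U V X) Y + \<beta> X (R U V Y) = 0"
          if \<beta>: "\<beta> \<in> \<B>" and all: "\<forall>\<beta>'\<in>\<B>. \<beta>' X Y = 0" for \<beta> U V X Y
        proof -
          obtain L where L: "length L = 2 * j + 2" and \<beta>: "\<beta> = (\<lambda>X Y. tensor_action R T (X # Y # L))"
            using \<beta> by (auto simp: \<B>_def)
          have "tensor_action R T (X # Y # L[i := R U V (L ! i)]) = 0" for i
          proof -
            have "(\<lambda>X Y. tensor_action R T (X # Y # L[i := R U V (L ! i)])) \<in> \<B>"
              unfolding \<B>_def using L
              by (intro CollectI exI[of _ "L[i := R U V (L ! i)]"]) (simp del: tensor_action_Cons2)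
            from bspec[OF all this] show ?thesis .
          qed
          then show ?thesis
            using Rpow_equivariant[OF M[OF L] z[OF L], of U V X Y]
            by (simp add: \<beta> del: tensor_action_Cons2)
        qed
        show "(\<lambda>X Y. tensor_action R T (X # Y # L)) \<in> \<B>"
          unfolding \<B>_def using L by blast
        show "tensor_action R T (U # V # L) \<noteq> 0"
          using nz by (simp add: Xs j T_def del: tensor_action_Cons2)
      qed
      then show False
      proof (elim disjE conjE exE)
        assume "\<forall>X. S (S X) = 0"
        with nilpotent_case_impossible[OF _ bil skew nondeg Suc.prems] rank show False by blast
      next
        fix b
        assume "\<kappa> \<noteq> 0" "\<forall>X. S (S X) = \<kappa> *\<^sub>R S X" "\<forall>X. \<exists>t. X = (1 / \<kappa>) *\<^sub>R S X + t *\<^sub>R b"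
        with projection_case_impossible[OF _ _ dim _ bil skew nondeg Suc.prems] rank show False by blast
      qed
    qed
  qed
qed

end

section \<open>Calculus of smooth maps\<close>

lemma differentiable_derivative:
  "g differentiable (at y) \<Longrightarrow> (g has_derivative frechet_derivative g (at y)) (at y)"
  by (simp only: frechet_derivative_works)

lemma Ck_on_cong:
  assumes "open W" "\<And>y. y \<in> W \<Longrightarrow> g y = g' y" "Ck_on k W g"
  shows "Ck_on k W g'"
  using assms(2,3)
proof (induction k arbitrary: g g')
  case 0
  then show ?case by (simp add: continuous_on_cong[of W W g g'])
next
  case (Suc k)
  have D: "g differentiable (at y)" if "y \<in> W" for y using Suc.prems(2) that by simp
  have eq: "frechet_derivative g (at y) = frechet_derivative g' (at y)" if "y \<in> W" for y
    by (rule frechet_derivative_transform_within_open[OF D assms(1)]) (use that Suc.prems(1) in auto)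
  have "g' differentiable (at y)" if "y \<in> W" for y
    using has_derivative_transform_within_open[OF differentiable_derivative[OF D[OF that]] assms(1) that]
      Suc.prems(1) unfolding differentiable_def by blast
  moreover have "Ck_on k W (\<lambda>y. frechet_derivative g' (at y) v)" for v
    by (rule Suc.IH[of "\<lambda>y. frechet_derivative g (at y) v"]) (use eq Suc.prems(2) in auto)
  ultimately show ?case by simp
qed

lemma Ck_on_subset: "Ck_on k W g \<Longrightarrow> V \<subseteq> W \<Longrightarrow> Ck_on k V g"
proof (induction k arbitrary: g)
  case 0
  then show ?case by (auto intro: continuous_on_subset)
next
  case (Suc k)
  then show ?case by (simp add: subset_iff)
qed

lemma Ck_on_Suc_imp: "Ck_on (Suc k) W g \<Longrightarrow> Ck_on k W g"
proof (induction k arbitrary: g)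
  case 0
  then show ?case
    by (auto intro!: continuous_at_imp_continuous_on differentiable_imp_continuous_within)
next
  case (Suc k)
  then show ?case by (metis Ck_on.simps(2))
qed

text \<open>Differentiability classes are proved with any explicit derivative \<open>g'\<close>; the definition refers to the one
  chosen by \<open>frechet_derivative\<close>, which agrees with \<open>g'\<close> on the open set \<open>W\<close>.\<close>

lemma Ck_on_SucI:
  assumes "open W" "\<And>y. y \<in> W \<Longrightarrow> (g has_derivative g' y) (at y)"
    and "\<And>v. Ck_on k W (\<lambda>y. g' y v)"
  shows "Ck_on (Suc k) W g"
proof -
  have "frechet_derivative g (at y) = g' y" if "y \<in> W" for y
    using frechet_derivative_at[OF assms(2)[OF that]] by simp
  then have "Ck_on k W (\<lambda>y. frechet_derivative g (at y) v)" for v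
    by (intro Ck_on_cong[OF assms(1) _ assms(3)[of v]]) simp
  then show ?thesis
    using assms(2) by (auto simp: differentiable_def)
qed

lemma Ck_on_has_derivative:
  "Ck_on (Suc k) W g \<Longrightarrow> y \<in> W \<Longrightarrow> (g has_derivative frechet_derivative g (at y)) (at y)"
  by (simp add: differentiable_derivative)

lemma Ck_on_const: "open W \<Longrightarrow> Ck_on k W (\<lambda>_. a)"
proof (induction k arbitrary: a)
  case (Suc k)
  then show ?case by (intro Ck_on_SucI[of W _ "\<lambda>_ _. 0"]) auto
qed simp

lemma Ck_on_bounded_linear:
  assumes "open W" "bounded_linear L" "Ck_on k W g"
  shows "Ck_on k W (\<lambda>y. L (g y))"
  using assms(3)
proof (induction k arbitrary: g)
  case 0
  then show ?case using bounded_linear.continuous_on[OF assms(2)] by simp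
next
  case (Suc k)
  show ?case
    by (rule Ck_on_SucI[OF assms(1)
          bounded_linear.has_derivative[OF assms(2) Ck_on_has_derivative[OF Suc.prems]]])
      (use Suc in auto)
qed

lemma Ck_on_add:
  assumes "open W" "Ck_on k W f" "Ck_on k W g"
  shows "Ck_on k W (\<lambda>y. f y + g y)"
  using assms(2,3)
proof (induction k arbitrary: f g)
  case 0
  then show ?case by (simp add: continuous_on_add)
next
  case (Suc k)
  show ?case
    by (rule Ck_on_SucI[OF assms(1) has_derivative_add[OF Ck_on_has_derivative[OF Suc.prems(1)]
          Ck_on_has_derivative[OF Suc.prems(2)]]])
      (use Suc in auto)
qed

lemma Ck_on_sum:
  assumes "open W" "\<And>i. i \<in> I \<Longrightarrow> Ck_on k W (f i)"
  shows "Ck_on k W (\<lambda>y. \<Sum>i\<in>I. f i y)"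
  using assms(2)
  by (induction I rule: infinite_finite_induct) (auto intro: Ck_on_const Ck_on_add assms(1))

lemma Ck_on_bounded_bilinear:
  assumes "open W" "bounded_bilinear B" "Ck_on k W f" "Ck_on k W g"
  shows "Ck_on k W (\<lambda>y. B (f y) (g y))"
  using assms(3,4)
proof (induction k arbitrary: f g)
  case 0
  then show ?case by (simp add: bounded_bilinear.continuous_on[OF assms(2)])
next
  case (Suc k)
  show ?case
  proof (rule Ck_on_SucI[OF assms(1) bounded_bilinear.FDERIV[OF assms(2)
          Ck_on_has_derivative[OF Suc.prems(1)] Ck_on_has_derivative[OF Suc.prems(2)]]])
    show "Ck_on k W (\<lambda>y. B (f y) (frechet_derivative g (at y) v) + B (frechet_derivative f (at y) v) (g y))" for v
      using Suc.prems Suc.prems[THEN Ck_on_Suc_imp]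
      by (intro Ck_on_add[OF assms(1)] Suc.IH) auto
  qed auto
qed

lemmas Ck_on_mult = Ck_on_bounded_bilinear[OF _ bounded_bilinear_mult]
lemmas Ck_on_scaleR = Ck_on_bounded_bilinear[OF _ bounded_bilinear_scaleR]

text \<open>The chain rule is expanded over a basis, \<open>D(g \<circ> f) v = \<Sum>\<^sub>e (Df v)\<^sub>e (D\<^sub>e g \<circ> f)\<close>, because \<open>Ck_on\<close> speaks only of
  derivatives in a fixed direction.\<close>

lemma Ck_on_compose:
  fixes f :: "'a::real_normed_vector \<Rightarrow> 'b::euclidean_space" and g :: "'b \<Rightarrow> 'c::real_normed_vector"
  assumes "open W" "Ck_on k V g" "Ck_on k W f" "f ` W \<subseteq> V"
  shows "Ck_on k W (\<lambda>y. g (f y))"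
  using assms(2,3)
proof (induction k arbitrary: g)
  case 0
  then show ?case using assms(4) continuous_on_compose2[of V g W f] by simp
next
  case (Suc k)
  have dg: "(g has_derivative frechet_derivative g (at (f y))) (at (f y))" if "y \<in> W" for y
    by (rule Ck_on_has_derivative[OF Suc.prems(1)]) (use assms(4) that in blast)
  show ?case
  proof (rule Ck_on_SucI[OF assms(1) has_derivative_compose[OF Ck_on_has_derivative[OF Suc.prems(2)] dg]])
    fix v
    have eq: "(\<Sum>e\<in>Basis. (frechet_derivative f (at y) v \<bullet> e) *\<^sub>R frechet_derivative g (at (f y)) e) =
        frechet_derivative g (at (f y)) (frechet_derivative f (at y) v)" if "y \<in> W" for y
      by (simp add: linear_scale[OF has_derivative_linear[OF dg[OF that]], symmetric]
          linear_sum[OF has_derivative_linear[OF dg[OF that]], symmetric] euclidean_representation)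
    have "Ck_on k W (\<lambda>y. (frechet_derivative f (at y) v \<bullet> e) *\<^sub>R frechet_derivative g (at (f y)) e)" for e
      using Suc.prems Ck_on_Suc_imp[OF Suc.prems(2)]
      by (intro Ck_on_scaleR[OF assms(1)] Suc.IH Ck_on_bounded_linear[OF assms(1) bounded_linear_inner_left]) auto
    then show "Ck_on k W (\<lambda>y. frechet_derivative g (at (f y)) (frechet_derivative f (at y) v))"
      by (intro Ck_on_cong[OF assms(1) eq] Ck_on_sum[OF assms(1)])
  qed auto
qed

lemma Ck_on_inverse:
  fixes g :: "'a::real_normed_vector \<Rightarrow> real"
  assumes "open W" "Ck_on k W g" "\<And>y. y \<in> W \<Longrightarrow> g y \<noteq> 0"
  shows "Ck_on k W (\<lambda>y. inverse (g y))"
  using assms(2)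
proof (induction k)
  case 0
  then show ?case using assms(3) by (simp add: continuous_on_inverse)
next
  case (Suc k)
  have inv: "Ck_on k W (\<lambda>y. inverse (g y))" using Suc Ck_on_Suc_imp by blast
  show ?case
  proof (rule Ck_on_SucI[OF assms(1) Deriv.has_derivative_inverse[OF assms(3) Ck_on_has_derivative[OF Suc.prems]]])
    show "Ck_on k W (\<lambda>y. - (inverse (g y) * frechet_derivative g (at y) v * inverse (g y)))" for v
      using Suc.prems inv
      by (intro Ck_on_bounded_linear[OF assms(1) bounded_linear_minus[OF bounded_linear_ident]]
          Ck_on_mult assms(1)) auto
  qed auto
qed

lemma Ck_on_prod:
  fixes f :: "'i \<Rightarrow> 'a::real_normed_vector \<Rightarrow> real"
  assumes "open W" "\<And>i. i \<in> I \<Longrightarrow> Ck_on k W (f i)"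
  shows "Ck_on k W (\<lambda>y. \<Prod>i\<in>I. f i y)"
  using assms(2)
  by (induction I rule: infinite_finite_induct) (auto intro: Ck_on_const Ck_on_mult assms(1))

lemma smooth_on_cong:
  "open W \<Longrightarrow> (\<And>y. y \<in> W \<Longrightarrow> g y = g' y) \<Longrightarrow> smooth_on W g \<Longrightarrow> smooth_on W g'"
  unfolding smooth_on_def using Ck_on_cong by blast

lemma smooth_on_subset: "smooth_on W g \<Longrightarrow> V \<subseteq> W \<Longrightarrow> smooth_on V g"
  unfolding smooth_on_def using Ck_on_subset by blast

lemma smooth_on_has_derivative:
  "smooth_on W g \<Longrightarrow> y \<in> W \<Longrightarrow> (g has_derivative frechet_derivative g (at y)) (at y)"
  unfolding smooth_on_def using Ck_on_has_derivative by blast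

lemma smooth_on_derivative: "smooth_on W g \<Longrightarrow> smooth_on W (\<lambda>y. frechet_derivative g (at y) v)"
  unfolding smooth_on_def by (metis Ck_on.simps(2))

lemma smooth_on_const: "open W \<Longrightarrow> smooth_on W (\<lambda>_. a)"
  by (simp add: smooth_on_def Ck_on_const)

lemma smooth_on_sum: "open W \<Longrightarrow> (\<And>i. i \<in> I \<Longrightarrow> smooth_on W (f i)) \<Longrightarrow> smooth_on W (\<lambda>y. \<Sum>i\<in>I. f i y)"
  by (simp add: smooth_on_def Ck_on_sum)

lemma smooth_on_bounded_linear:
  "open W \<Longrightarrow> bounded_linear L \<Longrightarrow> smooth_on W g \<Longrightarrow> smooth_on W (\<lambda>y. L (g y))"
  by (simp add: smooth_on_def Ck_on_bounded_linear)

lemma smooth_on_scaleR: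
  "open W \<Longrightarrow> smooth_on W f \<Longrightarrow> smooth_on W g \<Longrightarrow> smooth_on W (\<lambda>y. f y *\<^sub>R g y)"
  by (simp add: smooth_on_def Ck_on_scaleR)

lemma smooth_on_mult:
  fixes f g :: "'a::real_normed_vector \<Rightarrow> real"
  shows "open W \<Longrightarrow> smooth_on W f \<Longrightarrow> smooth_on W g \<Longrightarrow> smooth_on W (\<lambda>y. f y * g y)"
  by (simp add: smooth_on_def Ck_on_mult)

lemma smooth_on_compose:
  fixes f :: "'a::real_normed_vector \<Rightarrow> 'b::euclidean_space" and g :: "'b \<Rightarrow> 'c::real_normed_vector"
  shows "open W \<Longrightarrow> smooth_on V g \<Longrightarrow> smooth_on W f \<Longrightarrow> f ` W \<subseteq> V \<Longrightarrow> smooth_on W (\<lambda>y. g (f y))"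
  unfolding smooth_on_def using Ck_on_compose by blast

lemma smooth_on_inverse:
  fixes g :: "'a::real_normed_vector \<Rightarrow> real"
  shows "open W \<Longrightarrow> smooth_on W g \<Longrightarrow> (\<And>y. y \<in> W \<Longrightarrow> g y \<noteq> 0) \<Longrightarrow> smooth_on W (\<lambda>y. inverse (g y))"
  by (simp add: smooth_on_def Ck_on_inverse)

lemma smooth_on_prod:
  fixes f :: "'i \<Rightarrow> 'a::real_normed_vector \<Rightarrow> real"
  shows "open W \<Longrightarrow> (\<And>i. i \<in> I \<Longrightarrow> smooth_on W (f i)) \<Longrightarrow> smooth_on W (\<lambda>y. \<Prod>i\<in>I. f i y)"
  by (simp add: smooth_on_def Ck_on_prod)

lemma smooth_on_vec_nth:
  fixes g :: "'a::real_normed_vector \<Rightarrow> real ^ 'k"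
  shows "open W \<Longrightarrow> smooth_on W g \<Longrightarrow> smooth_on W (\<lambda>y. g y $ i)"
  using smooth_on_bounded_linear[OF _ bounded_linear_vec_nth] by blast

lemma smooth_on_vec_lambda:
  fixes g :: "'k::finite \<Rightarrow> 'a::real_normed_vector \<Rightarrow> real"
  assumes "open W" "\<And>i. smooth_on W (g i)"
  shows "smooth_on W (\<lambda>y. \<chi> i. g i y)"
proof -
  have sm: "smooth_on W (\<lambda>y. \<Sum>i\<in>UNIV. g i y *\<^sub>R axis i 1)"
    by (intro smooth_on_sum smooth_on_scaleR smooth_on_const assms)
  have eq: "(\<Sum>i\<in>UNIV. g i y *\<^sub>R axis i 1) = (\<chi> i. g i y)" for y
    using basis_expansion[of "\<chi> i. g i y"] by (simp add: scalar_mult_eq_scaleR)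
  show ?thesis
    by (rule smooth_on_cong[OF assms(1) eq sm])
qed

lemma smooth_on_det:
  fixes B :: "'a::real_normed_vector \<Rightarrow> real ^ 'k ^ 'k"
  assumes "open W" "\<And>i j. smooth_on W (\<lambda>y. B y $ i $ j)"
  shows "smooth_on W (\<lambda>y. det (B y))"
  unfolding det_def
  by (intro smooth_on_sum smooth_on_mult smooth_on_prod smooth_on_const assms)

text \<open>Solutions of linear systems with smooth coefficients are smooth by Cramer's rule. This is how the
  components of smooth fields in the moving frame of a hypersurface are seen to be smooth.\<close>

lemma smooth_on_linear_system:
  fixes B :: "'a::real_normed_vector \<Rightarrow> real ^ 'k ^ 'k"
  assumes W: "open W" and B: "\<And>i j. smooth_on W (\<lambda>y. B y $ i $ j)" and b: "smooth_on W b"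
    and inv: "\<And>y. y \<in> W \<Longrightarrow> det (B y) \<noteq> 0" and eq: "\<And>y. y \<in> W \<Longrightarrow> B y *v u y = b y"
  shows "smooth_on W u"
proof -
  define N where "N k y = (\<chi> i j. if j = k then b y $ i else B y $ i $ j)" for k y
  have "smooth_on W (\<lambda>y. N k y $ i $ j)" for k i j
    using B smooth_on_vec_nth[OF W b] by (cases "j = k") (auto simp: N_def)
  then have sm: "smooth_on W (\<lambda>y. \<chi> k. det (N k y) * inverse (det (B y)))"
    by (intro smooth_on_vec_lambda smooth_on_mult smooth_on_inverse smooth_on_det W B inv)
  have cr: "(\<chi> k. det (N k y) * inverse (det (B y))) = u y" if "y \<in> W" for y
    using cramer[OF inv[OF that], of "u y" "b y"] eq[OF that] by (simp add: N_def divide_inverse)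
  show ?thesis
    by (rule smooth_on_cong[OF W cr sm])
qed

lemma DERIV_along_line:
  fixes g :: "'a::real_normed_vector \<Rightarrow> real"
  assumes "(g has_derivative g') (at (p + s *\<^sub>R a))"
  shows "((\<lambda>s. g (p + s *\<^sub>R a)) has_real_derivative g' a) (at s)"
proof -
  have "((\<lambda>s. p + s *\<^sub>R a) has_derivative (\<lambda>t. t *\<^sub>R a)) (at s)"
    by (auto intro!: derivative_eq_intros)
  from has_derivative_compose[OF this assms]
  have "((\<lambda>s. g (p + s *\<^sub>R a)) has_derivative (\<lambda>t. g' (t *\<^sub>R a))) (at s)" .
  moreover have "(\<lambda>t. g' (t *\<^sub>R a)) = (*) (g' a)"
    using linear_scale[OF has_derivative_linear[OF assms]] by (auto simp: mult.commute)
  ultimately show ?thesis by (simp add: has_field_derivative_def)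
qed

text \<open>The mean value theorem applied twice to the second difference, first in direction \<open>a\<close>, then in
  direction \<open>b\<close>.\<close>

lemma second_difference_mean_value:
  fixes g :: "'a::real_normed_vector \<Rightarrow> real"
  assumes g: "smooth_on W g" and r: "ball z r \<subseteq> W" and t: "t > 0" "t * (norm a + norm b) < r"
  shows "\<exists>p. dist z p \<le> t * (norm a + norm b) \<and>
     g (z + t *\<^sub>R a + t *\<^sub>R b) - g (z + t *\<^sub>R a) - g (z + t *\<^sub>R b) + g z =
     t\<^sup>2 * frechet_derivative (\<lambda>y. frechet_derivative g (at y) a) (at p) b"
proof -
  define G where "G y = frechet_derivative g (at y) a" for y
  have G: "smooth_on W G"
    using smooth_on_derivative[OF g] by (simp add: G_def[abs_def])
  have dist_le: "dist z (z + s *\<^sub>R a + q *\<^sub>R b) \<le> t * (norm a + norm b)"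
    if "0 \<le> s" "s \<le> t" "0 \<le> q" "q \<le> t" for s q
  proof -
    have "dist z (z + s *\<^sub>R a + q *\<^sub>R b) = norm (s *\<^sub>R a + q *\<^sub>R b)"
      by (simp add: dist_norm norm_minus_commute algebra_simps)
    also have "\<dots> \<le> s * norm a + q * norm b"
      using norm_triangle_ineq[of "s *\<^sub>R a" "q *\<^sub>R b"] that by simp
    also have "\<dots> \<le> t * norm a + t * norm b"
      using that by (intro add_mono mult_right_mono) auto
    finally show ?thesis by (simp add: distrib_left)
  qed
  have inW: "z + s *\<^sub>R a + q *\<^sub>R b \<in> W" if "0 \<le> s" "s \<le> t" "0 \<le> q" "q \<le> t" for s q
    using dist_le[OF that] t(2) r by (auto simp: subset_iff)
  have d1: "((\<lambda>s. g (z + s *\<^sub>R a + t *\<^sub>R b) - g (z + s *\<^sub>R a)) has_real_derivative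
      G (z + s *\<^sub>R a + t *\<^sub>R b) - G (z + s *\<^sub>R a)) (at s)" if "0 \<le> s" "s \<le> t" for s
  proof (rule DERIV_diff)
    show "((\<lambda>s. g (z + s *\<^sub>R a)) has_real_derivative G (z + s *\<^sub>R a)) (at s)"
      unfolding G_def
      by (rule DERIV_along_line[OF smooth_on_has_derivative[OF g]]) (use inW[of s 0] that t in simp)
    have "(g has_derivative frechet_derivative g (at ((z + t *\<^sub>R b) + s *\<^sub>R a))) (at ((z + t *\<^sub>R b) + s *\<^sub>R a))"
      by (rule smooth_on_has_derivative[OF g]) (use inW[of s t] that t in \<open>simp add: algebra_simps\<close>)
    from DERIV_along_line[OF this]
    show "((\<lambda>s. g (z + s *\<^sub>R a + t *\<^sub>R b)) has_real_derivative G (z + s *\<^sub>R a + t *\<^sub>R b)) (at s)"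
      by (simp add: G_def algebra_simps)
  qed
  obtain s where s: "0 < s" "s < t" and eq1:
    "(g (z + t *\<^sub>R a + t *\<^sub>R b) - g (z + t *\<^sub>R a)) - (g (z + 0 *\<^sub>R a + t *\<^sub>R b) - g (z + 0 *\<^sub>R a))
      = (t - 0) * (G (z + s *\<^sub>R a + t *\<^sub>R b) - G (z + s *\<^sub>R a))"
    using MVT2[OF t(1) d1] by auto
  have d2: "((\<lambda>q. G (z + s *\<^sub>R a + q *\<^sub>R b)) has_real_derivative
      frechet_derivative G (at (z + s *\<^sub>R a + q *\<^sub>R b)) b) (at q)" if "0 \<le> q" "q \<le> t" for q
    by (rule DERIV_along_line[OF smooth_on_has_derivative[OF G]]) (use inW[of s q] s that in simp)
  obtain q where q: "0 < q" "q < t" and eq2: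
    "G (z + s *\<^sub>R a + t *\<^sub>R b) - G (z + s *\<^sub>R a + 0 *\<^sub>R b) =
      (t - 0) * frechet_derivative G (at (z + s *\<^sub>R a + q *\<^sub>R b)) b"
    using MVT2[OF t(1) d2] by blast
  show ?thesis
    by (rule exI[of _ "z + s *\<^sub>R a + q *\<^sub>R b"])
      (use dist_le[of s q] s q eq1 eq2 in \<open>simp add: G_def[abs_def] power2_eq_square\<close>)
qed

text \<open>The second difference is symmetric in \<open>a\<close> and \<open>b\<close>. Writing it as \<open>t\<^sup>2\<close> times either mixed derivative at
  nearby points, continuity of both derivatives gives the equality.\<close>

lemma second_derivative_symmetric_real:
  fixes g :: "'a::real_normed_vector \<Rightarrow> real"
  assumes W: "open W" "z \<in> W" and g: "smooth_on W g"
  shows "frechet_derivative (\<lambda>y. frechet_derivative g (at y) a) (at z) b =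
         frechet_derivative (\<lambda>y. frechet_derivative g (at y) b) (at z) a"
proof (rule ccontr)
  define P where "P p = frechet_derivative (\<lambda>y. frechet_derivative g (at y) a) (at p) b" for p
  define Q where "Q p = frechet_derivative (\<lambda>y. frechet_derivative g (at y) b) (at p) a" for p
  assume "\<not> ?thesis"
  then have ne: "P z \<noteq> Q z" by (simp add: P_def Q_def)
  define e where "e = \<bar>P z - Q z\<bar> / 2"
  have e: "e > 0" using ne by (simp add: e_def)
  have "smooth_on W P" "smooth_on W Q"
    unfolding P_def Q_def by (intro smooth_on_derivative g)+
  then have "isCont P z" "isCont Q z"
    using smooth_on_has_derivative[OF _ W(2)] has_derivative_continuous by blast+
  then obtain d1 d2 where d: "d1 > 0" "\<And>p. dist p z < d1 \<Longrightarrow> dist (P p) (P z) < e"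
      "d2 > 0" "\<And>p. dist p z < d2 \<Longrightarrow> dist (Q p) (Q z) < e"
    unfolding continuous_at_eps_delta using e by metis
  obtain r where r: "r > 0" "ball z r \<subseteq> W"
    using W openE by blast
  define m where "m = min r (min d1 d2)"
  define t where "t = m / (norm a + norm b + 1)"
  have m: "m > 0" using r d by (simp add: m_def)
  have n: "norm a + norm b + 1 > 0" by (simp add: add_nonneg_pos)
  have t: "t > 0" using m n by (simp add: t_def)
  have "t * (norm a + norm b + 1) = m" using n by (simp add: t_def)
  then have tm: "t * (norm a + norm b) < m" using t by (simp add: distrib_left)
  then have tr: "t * (norm a + norm b) < r" "t * (norm b + norm a) < r" by (auto simp: m_def add.commute)
  obtain p where p: "dist z p \<le> t * (norm a + norm b)"
     "g (z + t *\<^sub>R a + t *\<^sub>R b) - g (z + t *\<^sub>R a) - g (z + t *\<^sub>R b) + g z = t\<^sup>2 * P p"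
    using second_difference_mean_value[OF g r(2) t tr(1)] unfolding P_def by blast
  obtain q where q: "dist z q \<le> t * (norm b + norm a)"
     "g (z + t *\<^sub>R b + t *\<^sub>R a) - g (z + t *\<^sub>R b) - g (z + t *\<^sub>R a) + g z = t\<^sup>2 * Q q"
    using second_difference_mean_value[OF g r(2) t tr(2)] unfolding Q_def by blast
  have "z + t *\<^sub>R b + t *\<^sub>R a = z + t *\<^sub>R a + t *\<^sub>R b" by (simp add: algebra_simps)
  then have "t\<^sup>2 * P p = t\<^sup>2 * Q q" using p(2) q(2) by (simp only:)
  then have "P p = Q q" using t by simp
  moreover have "dist (P p) (P z) < e" "dist (Q q) (Q z) < e"
    using p(1) q(1) tm by (auto intro!: d(2,4) simp: m_def dist_commute add.commute)
  ultimately have "\<bar>P z - Q z\<bar> < 2 * e" by (simp add: dist_real_def)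
  then show False by (simp add: e_def)
qed

lemma second_derivative_symmetric:
  fixes g :: "'a::real_normed_vector \<Rightarrow> 'b::euclidean_space"
  assumes W: "open W" "z \<in> W" and g: "smooth_on W g"
  shows "frechet_derivative (\<lambda>y. frechet_derivative g (at y) a) (at z) b =
         frechet_derivative (\<lambda>y. frechet_derivative g (at y) b) (at z) a"
proof (rule euclidean_eqI)
  fix e :: 'b
  have inner: "frechet_derivative (\<lambda>y. k y \<bullet> e) (at y) v = frechet_derivative k (at y) v \<bullet> e"
    if "smooth_on W k" "y \<in> W" for k y v
    using frechet_derivative_at[OF has_derivative_inner_left[OF smooth_on_has_derivative[OF that]]]
    by metis
  have eq: "frechet_derivative (\<lambda>y. frechet_derivative (\<lambda>y. g y \<bullet> e) (at y) a) (at z) b =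
      frechet_derivative (\<lambda>y. frechet_derivative g (at y) a) (at z) b \<bullet> e" for a b
  proof -
    have "frechet_derivative (\<lambda>y. frechet_derivative g (at y) a \<bullet> e) (at z) =
       frechet_derivative (\<lambda>y. frechet_derivative (\<lambda>y. g y \<bullet> e) (at y) a) (at z)"
      using smooth_on_has_derivative[OF smooth_on_bounded_linear[OF W(1) bounded_linear_inner_left
            smooth_on_derivative[OF g]] W(2)] inner[OF g]
      by (intro frechet_derivative_transform_within_open[OF _ W]) (auto simp: differentiable_def)
    then show ?thesis
      using inner[OF smooth_on_derivative[OF g] W(2), of a b] by metis
  qed
  have "smooth_on W (\<lambda>y. g y \<bullet> e)"
    by (rule smooth_on_bounded_linear[OF W(1) bounded_linear_inner_left g])
  from second_derivative_symmetric_real[OF W this, of a b]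
  show "frechet_derivative (\<lambda>y. frechet_derivative g (at y) a) (at z) b \<bullet> e =
      frechet_derivative (\<lambda>y. frechet_derivative g (at y) b) (at z) a \<bullet> e"
    by (simp add: eq)
qed

section \<open>Structure equations of a hypersurface in coordinates\<close>

lemma smooth_on_directional_derivative:
  fixes K :: "'a::euclidean_space \<Rightarrow> 'b::real_normed_vector"
  assumes W: "open W" and K: "smooth_on W K" and p: "smooth_on W p"
  shows "smooth_on W (\<lambda>z. frechet_derivative K (at z) (p z))"
proof -
  have sm: "smooth_on W (\<lambda>z. \<Sum>e\<in>Basis. (p z \<bullet> e) *\<^sub>R frechet_derivative K (at z) e)"
    by (intro smooth_on_sum smooth_on_scaleR W smooth_on_derivative K
        smooth_on_bounded_linear[OF W bounded_linear_inner_left p])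
  have eq: "(\<Sum>e\<in>Basis. (p z \<bullet> e) *\<^sub>R frechet_derivative K (at z) e) = frechet_derivative K (at z) (p z)"
    if "z \<in> W" for z
    by (simp add: linear_scale[OF has_derivative_linear[OF smooth_on_has_derivative[OF K that]], symmetric]
        linear_sum[OF has_derivative_linear[OF smooth_on_has_derivative[OF K that]], symmetric]
        euclidean_representation)
  show ?thesis
    by (rule smooth_on_cong[OF W eq sm])
qed

text \<open>The product rule for \<open>z \<mapsto> D\<^sub>p\<^sub>(\<^sub>z\<^sub>)K(z)\<close>.\<close>

lemma derivative_of_directional_derivative:
  fixes K :: "'a::euclidean_space \<Rightarrow> 'b::real_normed_vector"
  assumes W: "open W" "z \<in> W" and K: "smooth_on W K" and p: "smooth_on W p"
  shows "frechet_derivative (\<lambda>z. frechet_derivative K (at z) (p z)) (at z) a =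
     frechet_derivative (\<lambda>y. frechet_derivative K (at y) (p z)) (at z) a
     + frechet_derivative K (at z) (frechet_derivative p (at z) a)"
proof -
  have lin: "linear (frechet_derivative K (at y))" if "y \<in> W" for y
    using has_derivative_linear[OF smooth_on_has_derivative[OF K that]] .
  have sum: "frechet_derivative K (at y) v = (\<Sum>e\<in>Basis. (v \<bullet> e) *\<^sub>R frechet_derivative K (at y) e)"
    if "y \<in> W" for y v
    by (simp add: linear_scale[OF lin[OF that], symmetric] linear_sum[OF lin[OF that], symmetric]
        euclidean_representation)
  have dK: "((\<lambda>y. frechet_derivative K (at y) v) has_derivative
      frechet_derivative (\<lambda>y. frechet_derivative K (at y) v) (at z)) (at z)" for v
    by (rule smooth_on_has_derivative[OF smooth_on_derivative[OF K] W(2)])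
  have dp: "(p has_derivative frechet_derivative p (at z)) (at z)"
    by (rule smooth_on_has_derivative[OF p W(2)])
  define D where "D v a = (\<Sum>e\<in>Basis. (v \<bullet> e) *\<^sub>R frechet_derivative (\<lambda>y. frechet_derivative K (at y) e) (at z) a)"
    for v a
  have 1: "((\<lambda>y. frechet_derivative K (at y) v) has_derivative D v) (at z)" for v
  proof -
    have "((\<lambda>y. \<Sum>e\<in>Basis. (v \<bullet> e) *\<^sub>R frechet_derivative K (at y) e) has_derivative D v) (at z)"
      unfolding D_def by (intro has_derivative_sum has_derivative_scaleR_right dK)
    then show ?thesis
      by (rule has_derivative_transform_within_open[OF _ W]) (rule sum[symmetric])
  qed
  have "((\<lambda>y. \<Sum>e\<in>Basis. (p y \<bullet> e) *\<^sub>R frechet_derivative K (at y) e) has_derivative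
     (\<lambda>a. \<Sum>e\<in>Basis. (p z \<bullet> e) *\<^sub>R frechet_derivative (\<lambda>y. frechet_derivative K (at y) e) (at z) a
       + (frechet_derivative p (at z) a \<bullet> e) *\<^sub>R frechet_derivative K (at z) e)) (at z)"
    by (intro has_derivative_sum has_derivative_scaleR dK has_derivative_inner_left dp)
  then have "((\<lambda>y. frechet_derivative K (at y) (p y)) has_derivative
      (\<lambda>a. D (p z) a + frechet_derivative K (at z) (frechet_derivative p (at z) a))) (at z)"
    unfolding sum.distrib D_def sum[OF W(2), symmetric]
    by (rule has_derivative_transform_within_open[OF _ W]) (rule sum[symmetric])
  from fun_cong[OF frechet_derivative_at[OF this], of a] fun_cong[OF frechet_derivative_at[OF 1[of "p z"]], of a]
  show ?thesis by simp
qed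

text \<open>A hypersurface with transversal field \<open>N\<close>, parametrized by an open set of \<open>\<real>\<^sup>n\<close>. The formulas of Gauss and
  Weingarten are required for constant fields only; \<open>\<Gamma> a b\<close> is the field \<open>\<nabla>\<^sub>a b\<close>, whose components are
  Christoffel symbols, and \<open>H\<close>, \<open>Sh\<close>, \<open>t\<close> are the coordinate expressions of \<open>h\<close>, \<open>S\<close>, \<open>\<tau>\<close>.\<close>

locale coordinate_hypersurface =
  fixes W :: "(real ^ 'n) set" and F N :: "real ^ 'n \<Rightarrow> real ^ 'k"
    and \<Gamma> :: "real ^ 'n \<Rightarrow> real ^ 'n \<Rightarrow> real ^ 'n \<Rightarrow> real ^ 'n"
    and H :: "real ^ 'n \<Rightarrow> real ^ 'n \<Rightarrow> real ^ 'n \<Rightarrow> real"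
    and Sh :: "real ^ 'n \<Rightarrow> real ^ 'n \<Rightarrow> real ^ 'n" and t :: "real ^ 'n \<Rightarrow> real ^ 'n \<Rightarrow> real"
  assumes W: "open W" and F: "smooth_on W F" and N: "smooth_on W N"
    and card: "CARD('k) = CARD('n) + 1"
    and spans: "z \<in> W \<Longrightarrow> span (insert (N z) (range (frechet_derivative F (at z)))) = UNIV"
    and gauss: "z \<in> W \<Longrightarrow> frechet_derivative (\<lambda>y. frechet_derivative F (at y) b) (at z) a =
       frechet_derivative F (at z) (\<Gamma> a b z) + H z a b *\<^sub>R N z"
    and weingarten: "z \<in> W \<Longrightarrow> frechet_derivative N (at z) a =
       - frechet_derivative F (at z) (Sh z a) + t z a *\<^sub>R N z"
begin

abbreviation dF :: "real ^ 'n \<Rightarrow> real ^ 'n \<Rightarrow> real ^ 'k" where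
  "dF z \<equiv> frechet_derivative F (at z)"

lemma dF_linear: "z \<in> W \<Longrightarrow> linear (dF z)"
  using has_derivative_linear[OF smooth_on_has_derivative[OF F]] .

text \<open>The frame \<open>\<partial>\<^sub>1F, \<dots>, \<partial>\<^sub>nF, N\<close> as a square matrix. Its columns are indexed by \<open>'k\<close>, so an embedding \<open>e\<close> of the
  index type \<open>'n\<close> into \<open>'k\<close> is chosen, with \<open>e0\<close> the index left over for \<open>N\<close>.\<close>

lemma frame_matrix:
  obtains B :: "real ^ 'n \<Rightarrow> real ^ 'k ^ 'k" and e :: "'n \<Rightarrow> 'k" and e0 :: 'k
  where "\<And>i j. smooth_on W (\<lambda>z. B z $ i $ j)" and "\<And>z. z \<in> W \<Longrightarrow> det (B z) \<noteq> 0"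
    and "inj e" and "e0 \<notin> range e"
    and "\<And>z v s. z \<in> W \<Longrightarrow> B z *v (\<chi> j. if j = e0 then s else v $ inv e j) = dF z v + s *\<^sub>R N z"
proof -
  obtain e :: "'n \<Rightarrow> 'k" where e: "inj e"
    using card by (metis card_le_inj finite_class.finite_UNIV le_add1)
  have "card (range e) < CARD('k)"
    using card card_image[OF e] by simp
  then obtain e0 where e0: "e0 \<notin> range e"
    by (metis UNIV_eq_I less_irrefl)
  have range: "j \<in> range e" if "j \<noteq> e0" for j
  proof -
    have "card (insert e0 (range e)) = CARD('k)"
      using card card_image[OF e] e0 by simp
    then have "insert e0 (range e) = UNIV"
      by (simp add: card_eq_UNIV_imp_eq_UNIV)
    then show ?thesis using that by blast
  qed
  define B where "B z = (\<chi> i j. if j = e0 then N z $ i else dF z (axis (inv e j) 1) $ i)" for z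
  have mult: "B z *v (\<chi> j. if j = e0 then s else v $ inv e j) = dF z v + s *\<^sub>R N z" if "z \<in> W" for z v s
  proof -
    have UN: "UNIV = insert e0 (range e)" using range by blast
    have "dF z v = dF z (\<Sum>i\<in>UNIV. v $ i *\<^sub>R axis i 1)"
      using basis_expansion[of v] by (simp add: scalar_mult_eq_scaleR)
    also have "\<dots> = (\<Sum>i\<in>UNIV. v $ i *\<^sub>R dF z (axis i 1))"
      by (simp add: linear_sum[OF dF_linear[OF that]] linear_scale[OF dF_linear[OF that]])
    finally have dv: "dF z v $ r = (\<Sum>i\<in>UNIV. v $ i * dF z (axis i 1) $ r)" for r by simp
    show ?thesis
    proof (rule vec_eq_iff[THEN iffD2], rule allI)
      fix r
      have "(B z *v (\<chi> j. if j = e0 then s else v $ inv e j)) $ r =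
        (\<Sum>j\<in>insert e0 (range e). B z $ r $ j * (if j = e0 then s else v $ inv e j))"
        by (simp add: matrix_vector_mult_def UN[symmetric])
      also have "\<dots> = N z $ r * s + (\<Sum>j\<in>range e. B z $ r $ j * (if j = e0 then s else v $ inv e j))"
        using e0 by (simp add: B_def)
      also have "(\<Sum>j\<in>range e. B z $ r $ j * (if j = e0 then s else v $ inv e j)) =
         (\<Sum>i\<in>UNIV. B z $ r $ e i * (if e i = e0 then s else v $ inv e (e i)))"
        by (simp add: sum.reindex[OF e] o_def)
      also have "\<dots> = (\<Sum>i\<in>UNIV. v $ i * dF z (axis i 1) $ r)"
        using e0 by (intro sum.cong) (auto simp: B_def inv_f_f[OF e])
      finally show "(B z *v (\<chi> j. if j = e0 then s else v $ inv e j)) $ r = (dF z v + s *\<^sub>R N z) $ r"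
        by (simp add: dv mult.commute)
    qed
  qed
  have det: "det (B z) \<noteq> 0" if "z \<in> W" for z
  proof -
    have "insert (N z) (range (dF z)) \<subseteq> range ((*v) (B z))"
    proof -
      have "N z = B z *v (\<chi> j. if j = e0 then 1 else 0 $ inv e j)"
        using mult[OF that, of 1 0] linear_0[OF dF_linear[OF that]] by simp
      moreover have "dF z v = B z *v (\<chi> j. if j = e0 then 0 else v $ inv e j)" for v
        using mult[OF that, of 0 v] by simp
      ultimately show ?thesis by blast
    qed
    moreover have "subspace (range ((*v) (B z)))"
      by (intro linear_subspace_image subspace_UNIV matrix_vector_mul_linear)
    ultimately have "range ((*v) (B z)) = UNIV"
      using span_minimal spans[OF that] by blast
    then have "\<exists>B'. B z ** B' = mat 1"
      by (simp add: matrix_right_invertible_surjective)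
    then have "invertible (B z)"
      by (simp add: invertible_right_inverse)
    then show ?thesis by (simp add: invertible_det_nz)
  qed
  have "smooth_on W (\<lambda>z. B z $ i $ j)" for i j
    using smooth_on_vec_nth[OF W N] smooth_on_vec_nth[OF W smooth_on_derivative[OF F]]
    by (cases "j = e0") (simp_all add: B_def)
  from that[OF this det e e0 mult] show ?thesis .
qed

lemma frame_unique:
  assumes z: "z \<in> W" and eq: "dF z a + s *\<^sub>R N z = dF z a' + s' *\<^sub>R N z"
  shows "a = a'" "s = s'"
proof -
  obtain B :: "real ^ 'n \<Rightarrow> real ^ 'k ^ 'k" and e :: "'n \<Rightarrow> 'k" and e0
    where "\<And>i j. smooth_on W (\<lambda>z. B z $ i $ j)" and B: "\<And>z. z \<in> W \<Longrightarrow> det (B z) \<noteq> 0"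
    and e: "inj e" "e0 \<notin> range e"
    and mult: "\<And>z v s. z \<in> W \<Longrightarrow> B z *v (\<chi> j. if j = e0 then s else v $ inv e j) = dF z v + s *\<^sub>R N z"
    by (rule frame_matrix) blast
  have "inj ((*v) (B z))"
    using B[OF z] by (simp add: invertible_det_nz[symmetric] invertible_left_inverse matrix_left_invertible_injective)
  moreover have "B z *v (\<chi> j. if j = e0 then s else a $ inv e j) = B z *v (\<chi> j. if j = e0 then s' else a' $ inv e j)"
    using eq by (simp add: mult[OF z])
  ultimately have eq: "(\<chi> j. if j = e0 then s else a $ inv e j) = (\<chi> j. if j = e0 then s' else a' $ inv e j)"
    by (rule injD)
  show "s = s'" using arg_cong[OF eq, of "\<lambda>v. v $ e0"] by simp
  have "a $ i = a' $ i" for i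
  proof -
    have "e i \<noteq> e0" using e by auto
    then show ?thesis
      using arg_cong[OF eq, of "\<lambda>v. v $ e i"] by (simp add: inv_f_f[OF e(1)])
  qed
  then show "a = a'" by (simp add: vec_eq_iff)
qed

lemma frame_components_smooth:
  assumes r: "smooth_on W r" and eq: "\<And>z. z \<in> W \<Longrightarrow> r z = dF z (u z) + s z *\<^sub>R N z"
  shows "smooth_on W u" "smooth_on W s"
proof -
  obtain B :: "real ^ 'n \<Rightarrow> real ^ 'k ^ 'k" and e :: "'n \<Rightarrow> 'k" and e0
    where B: "\<And>i j. smooth_on W (\<lambda>z. B z $ i $ j)" "\<And>z. z \<in> W \<Longrightarrow> det (B z) \<noteq> 0"
    and e: "inj e" "e0 \<notin> range e"
    and mult: "\<And>z v s. z \<in> W \<Longrightarrow> B z *v (\<chi> j. if j = e0 then s else v $ inv e j) = dF z v + s *\<^sub>R N z"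
    by (rule frame_matrix) blast
  have sm: "smooth_on W (\<lambda>z. \<chi> j. if j = e0 then s z else u z $ inv e j)"
    by (rule smooth_on_linear_system[OF W B(1) r B(2)]) (simp_all add: mult eq)
  from smooth_on_vec_nth[OF W this, of e0] show "smooth_on W s" by simp
  have "smooth_on W (\<lambda>z. u z $ i)" for i
  proof -
    have "e i \<noteq> e0" using e by auto
    then show ?thesis
      using smooth_on_vec_nth[OF W sm, of "e i"] by (simp add: inv_f_f[OF e(1)])
  qed
  then have "smooth_on W (\<lambda>z. \<chi> i. u z $ i)"
    by (rule smooth_on_vec_lambda[OF W])
  then show "smooth_on W u" by simp
qed

lemma dF_smooth: "smooth_on W p \<Longrightarrow> smooth_on W (\<lambda>z. dF z (p z))"
  by (rule smooth_on_directional_derivative[OF W F])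

lemma \<Gamma>_smooth: "smooth_on W (\<Gamma> a b)" and H_smooth: "smooth_on W (\<lambda>z. H z a b)"
proof -
  have "smooth_on W (\<lambda>z. frechet_derivative (\<lambda>y. frechet_derivative F (at y) b) (at z) a)"
    by (intro smooth_on_derivative F)
  from frame_components_smooth[OF this gauss] show "smooth_on W (\<Gamma> a b)" "smooth_on W (\<lambda>z. H z a b)"
    by auto
qed

lemma Sh_smooth: "smooth_on W (\<lambda>z. Sh z a)" and t_smooth: "smooth_on W (\<lambda>z. t z a)"
proof -
  have eq: "frechet_derivative N (at z) a = dF z (- Sh z a) + t z a *\<^sub>R N z" if "z \<in> W" for z
    using weingarten[OF that] linear_neg[OF dF_linear[OF that]] by simp
  note sm = frame_components_smooth[OF smooth_on_derivative[OF N] eq]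
  show "smooth_on W (\<lambda>z. t z a)" by (rule sm(2))
  show "smooth_on W (\<lambda>z. Sh z a)"
    using smooth_on_bounded_linear[OF W bounded_linear_minus[OF bounded_linear_ident] sm(1)] by simp
qed

text \<open>The Gauss formula for a variable field \<open>p\<close>: its tangential part is \<open>\<nabla>\<^sub>ap = \<Gamma>(a,p) + \<partial>\<^sub>ap\<close>.\<close>

lemma gauss_field:
  assumes z: "z \<in> W" and p: "smooth_on W p"
  shows "frechet_derivative (\<lambda>y. dF y (p y)) (at z) a =
     dF z (\<Gamma> a (p z) z + frechet_derivative p (at z) a) + H z a (p z) *\<^sub>R N z"
  using derivative_of_directional_derivative[OF W z F p, of a] gauss[OF z, of "p z" a]
    linear_add[OF dF_linear[OF z]] by simp

lemma Sh_linear: "z \<in> W \<Longrightarrow> linear (Sh z)" and t_zero: "z \<in> W \<Longrightarrow> t z 0 = 0"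
proof -
  assume z: "z \<in> W"
  note lN = has_derivative_linear[OF smooth_on_has_derivative[OF N z]]
  note l = linear_add[OF dF_linear[OF z]] linear_scale[OF dF_linear[OF z]] linear_neg[OF dF_linear[OF z]]
    linear_diff[OF dF_linear[OF z]]
  show "linear (Sh z)"
  proof (rule linearI)
    fix a b
    have "dF z (- Sh z (a + b)) + t z (a + b) *\<^sub>R N z = dF z (- (Sh z a + Sh z b)) + (t z a + t z b) *\<^sub>R N z"
      using linear_add[OF lN, of a b] unfolding weingarten[OF z] by (simp add: l algebra_simps)
    from frame_unique(1)[OF z this] show "Sh z (a + b) = Sh z a + Sh z b"
      unfolding neg_equal_iff_equal .
  next
    fix r a
    have "dF z (- Sh z (r *\<^sub>R a)) + t z (r *\<^sub>R a) *\<^sub>R N z = dF z (- (r *\<^sub>R Sh z a)) + (r * t z a) *\<^sub>R N z"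
      using linear_scale[OF lN, of r a] unfolding weingarten[OF z] by (simp add: l algebra_simps)
    from frame_unique(1)[OF z this] show "Sh z (r *\<^sub>R a) = r *\<^sub>R Sh z a" by simp
  qed
  have "dF z (- Sh z 0) + t z 0 *\<^sub>R N z = dF z 0 + 0 *\<^sub>R N z"
    using linear_0[OF lN] linear_0[OF dF_linear[OF z]] unfolding weingarten[OF z] by (simp add: l)
  from frame_unique(2)[OF z this] show "t z 0 = 0" .
qed

lemma H_sym: "z \<in> W \<Longrightarrow> H z a b = H z b a"
  using second_derivative_symmetric[OF W _ F, of z a b] gauss[of z a b] gauss[of z b a]
  by (intro frame_unique(2)[of z "\<Gamma> a b z" _ "\<Gamma> b a z"]) simp_all

lemma H_bilinear: "z \<in> W \<Longrightarrow> bilinear (H z)"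
proof -
  assume z: "z \<in> W"
  note l = linear_add[OF dF_linear[OF z]] linear_scale[OF dF_linear[OF z]]
  have lin: "linear (\<lambda>a. H z a b)" for b
  proof -
    note l2 = has_derivative_linear[OF smooth_on_has_derivative[OF smooth_on_derivative[OF F, of b] z]]
    show ?thesis
    proof (rule linearI)
      fix a a'
      have "dF z (\<Gamma> (a + a') b z) + H z (a + a') b *\<^sub>R N z =
          dF z (\<Gamma> a b z + \<Gamma> a' b z) + (H z a b + H z a' b) *\<^sub>R N z"
        using linear_add[OF l2, of a a'] unfolding gauss[OF z] by (simp add: l algebra_simps)
      from frame_unique(2)[OF z this] show "H z (a + a') b = H z a b + H z a' b" .
    next
      fix r a
      have "dF z (\<Gamma> (r *\<^sub>R a) b z) + H z (r *\<^sub>R a) b *\<^sub>R N z =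
          dF z (r *\<^sub>R \<Gamma> a b z) + (r * H z a b) *\<^sub>R N z"
        using linear_scale[OF l2, of r a] unfolding gauss[OF z] by (simp add: l algebra_simps)
      from frame_unique(2)[OF z this] show "H z (r *\<^sub>R a) b = r *\<^sub>R H z a b" by simp
    qed
  qed
  moreover have "H z a = (\<lambda>b. H z b a)" for a
    using H_sym[OF z] by auto
  ultimately show "bilinear (H z)"
    unfolding bilinear_def by metis
qed

lemma third_derivative:
  assumes z: "z \<in> W"
  shows "frechet_derivative (\<lambda>y. frechet_derivative (\<lambda>y. dF y c) (at y) b) (at z) a =
    dF z (\<Gamma> a (\<Gamma> b c z) z + frechet_derivative (\<Gamma> b c) (at z) a - H z b c *\<^sub>R Sh z a)
    + (H z a (\<Gamma> b c z) + frechet_derivative (\<lambda>y. H y b c) (at z) a + H z b c * t z a) *\<^sub>R N z"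
proof -
  note d1 = smooth_on_has_derivative[OF dF_smooth[OF \<Gamma>_smooth[of b c]] z]
  note d2 = has_derivative_scaleR[OF smooth_on_has_derivative[OF H_smooth[of b c] z]
      smooth_on_has_derivative[OF N z]]
  have "((\<lambda>y. frechet_derivative (\<lambda>y. dF y c) (at y) b) has_derivative
      (\<lambda>a. frechet_derivative (\<lambda>y. dF y (\<Gamma> b c y)) (at z) a +
       (H z b c *\<^sub>R frechet_derivative N (at z) a + frechet_derivative (\<lambda>y. H y b c) (at z) a *\<^sub>R N z))) (at z)"
    by (rule has_derivative_transform_within_open[OF has_derivative_add[OF d1 d2] W z]) (simp add: gauss)
  from fun_cong[OF frechet_derivative_at[OF this], of a] show ?thesis
    by (simp add: gauss_field[OF z \<Gamma>_smooth] weingarten[OF z] linear_add[OF dF_linear[OF z]]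
        linear_diff[OF dF_linear[OF z]] linear_scale[OF dF_linear[OF z]] algebra_simps)
qed

text \<open>The left side is \<open>\<nabla>\<^sub>a\<nabla>\<^sub>bc - \<nabla>\<^sub>b\<nabla>\<^sub>ac\<close> for constant fields, whose brackets vanish. The equation is the
  tangential part of \<open>\<partial>\<^sub>a\<partial>\<^sub>b(\<partial>\<^sub>cF) = \<partial>\<^sub>b\<partial>\<^sub>a(\<partial>\<^sub>cF)\<close>.\<close>

lemma coordinate_gauss_equation:
  assumes z: "z \<in> W"
  shows "(\<Gamma> a (\<Gamma> b c z) z + frechet_derivative (\<Gamma> b c) (at z) a)
    - (\<Gamma> b (\<Gamma> a c z) z + frechet_derivative (\<Gamma> a c) (at z) b) =
    H z b c *\<^sub>R Sh z a - H z a c *\<^sub>R Sh z b"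
proof -
  have "frechet_derivative (\<lambda>y. frechet_derivative (\<lambda>y. dF y c) (at y) b) (at z) a =
      frechet_derivative (\<lambda>y. frechet_derivative (\<lambda>y. dF y c) (at y) a) (at z) b"
    by (rule second_derivative_symmetric[OF W z smooth_on_derivative[OF F]])
  from frame_unique(1)[OF z this[unfolded third_derivative[OF z]]]
  show ?thesis by (simp add: algebra_simps)
qed

text \<open>The transversal part of \<open>\<partial>\<^sub>a\<partial>\<^sub>bN = \<partial>\<^sub>b\<partial>\<^sub>aN\<close>; the right side is \<open>d\<tau>(a,b)\<close>.\<close>

lemma coordinate_ricci_equation:
  assumes z: "z \<in> W"
  shows "H z a (Sh z b) - H z b (Sh z a) =
    frechet_derivative (\<lambda>y. t y b) (at z) a - frechet_derivative (\<lambda>y. t y a) (at z) b"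
proof -
  have eq: "frechet_derivative (\<lambda>y. frechet_derivative N (at y) b) (at z) a =
     dF z (- \<Gamma> a (Sh z b) z - frechet_derivative (\<lambda>y. Sh y b) (at z) a - t z b *\<^sub>R Sh z a)
     + (frechet_derivative (\<lambda>y. t y b) (at z) a + t z b * t z a - H z a (Sh z b)) *\<^sub>R N z" for a b
  proof -
    note d1 = has_derivative_minus[OF smooth_on_has_derivative[OF dF_smooth[OF Sh_smooth[of b]] z]]
    note d2 = has_derivative_scaleR[OF smooth_on_has_derivative[OF t_smooth[of b] z]
      smooth_on_has_derivative[OF N z]]
    have "((\<lambda>y. frechet_derivative N (at y) b) has_derivative
      (\<lambda>a. - frechet_derivative (\<lambda>y. dF y (Sh y b)) (at z) a +
       (t z b *\<^sub>R frechet_derivative N (at z) a + frechet_derivative (\<lambda>y. t y b) (at z) a *\<^sub>R N z))) (at z)"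
      by (rule has_derivative_transform_within_open[OF has_derivative_add[OF d1 d2] W z]) (simp add: weingarten)
    from fun_cong[OF frechet_derivative_at[OF this], of a] show ?thesis
      by (simp add: gauss_field[OF z Sh_smooth] weingarten[OF z] linear_add[OF dF_linear[OF z]]
        linear_diff[OF dF_linear[OF z]] linear_neg[OF dF_linear[OF z]] linear_scale[OF dF_linear[OF z]] algebra_simps)
  qed
  from frame_unique(2)[OF z second_derivative_symmetric[OF W z N, of b a, unfolded eq]]
  show ?thesis by simp
qed

end

section \<open>Charts and coordinate fields\<close>

text \<open>All computations near a point take place in one fixed chart \<open>c\<close>, whereas tangent vectors at \<open>y\<close> are
  represented in the chart chosen at \<open>y\<close>.\<close>

locale manifold_chart =
  fixes M :: "'m topology" and A :: "('m, 'n::finite) chart set" and c :: "('m, 'n) chart"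
  assumes atlas: "smooth_atlas M A" and c: "c \<in> A"
begin

abbreviation "U \<equiv> chart_dom c"
abbreviation "\<phi> \<equiv> coord c"
abbreviation "\<psi> \<equiv> chart_inv c"
abbreviation "W \<equiv> \<phi> ` U"

lemma chart_dom_open: "d \<in> A \<Longrightarrow> openin M (chart_dom d)"
  using atlas by (simp add: smooth_atlas_def)

lemma chart_inj: "d \<in> A \<Longrightarrow> inj_on (coord d) (chart_dom d)"
  and chart_image_open: "d \<in> A \<Longrightarrow> openin M V \<Longrightarrow> V \<subseteq> chart_dom d \<Longrightarrow> open (coord d ` V)"
proof -
  assume d: "d \<in> A"
  have hom: "homeomorphic_map (subtopology M (chart_dom d)) (top_of_set (coord d ` chart_dom d)) (coord d)"
    and op: "open (coord d ` chart_dom d)"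
    using atlas d by (simp_all add: smooth_atlas_def)
  have sub: "chart_dom d \<subseteq> topspace M"
    using chart_dom_open[OF d] openin_subset by blast
  show "inj_on (coord d) (chart_dom d)"
    using homeomorphic_imp_injective_map[OF hom] sub by (simp add: Int_absorb1)
  assume V: "openin M V" "V \<subseteq> chart_dom d"
  have "openin (subtopology M (chart_dom d)) V"
    using V by (auto simp: openin_subtopology)
  then have "openin (top_of_set (coord d ` chart_dom d)) (coord d ` V)"
    using homeomorphic_imp_open_map[OF hom] by (simp add: open_map_def)
  then show "open (coord d ` V)"
    using op openin_open_eq by blast
qed

lemma chart_inv_left: "d \<in> A \<Longrightarrow> y \<in> chart_dom d \<Longrightarrow> chart_inv d (coord d y) = y"
  using chart_inj by (simp add: inv_into_f_f)

lemma transition_smooth: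
  "d \<in> A \<Longrightarrow> d' \<in> A \<Longrightarrow> smooth_on (coord d ` (chart_dom d \<inter> chart_dom d')) (coord d' \<circ> chart_inv d)"
  using atlas by (simp add: smooth_atlas_def)

lemma W_open: "open W"
  by (rule chart_image_open[OF c chart_dom_open[OF c]]) simp

lemma U_topspace: "y \<in> U \<Longrightarrow> y \<in> topspace M"
  using chart_dom_open[OF c] openin_subset by blast

lemma chart_at: "y \<in> topspace M \<Longrightarrow> chart_at A y \<in> A \<and> y \<in> chart_dom (chart_at A y)"
proof -
  assume "y \<in> topspace M"
  moreover have "(\<Union>d\<in>A. chart_dom d) = topspace M"
    using atlas by (simp add: smooth_atlas_def)
  ultimately have "\<exists>d. d \<in> A \<and> y \<in> chart_dom d" by blast
  then show ?thesis
    unfolding chart_at_def by (rule someI_ex)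
qed

text \<open>\<open>components y\<close> and \<open>vector_of y\<close> are the inverse isomorphisms between the representation of tangent
  vectors at \<open>y\<close> in the chart chosen at \<open>y\<close> and their components in \<open>c\<close>.\<close>

definition components :: "'m \<Rightarrow> real ^ 'n \<Rightarrow> real ^ 'n" where
  "components y = tangent_map A \<phi> y"

definition vector_of :: "'m \<Rightarrow> real ^ 'n \<Rightarrow> real ^ 'n" where
  "vector_of y = frechet_derivative (coord (chart_at A y) \<circ> \<psi>) (at (\<phi> y))"

lemma transition_has_derivative:
  assumes "d \<in> A" "d' \<in> A" "y \<in> chart_dom d" "y \<in> chart_dom d'"
  shows "((coord d' \<circ> chart_inv d) has_derivative frechet_derivative (coord d' \<circ> chart_inv d) (at (coord d y)))
    (at (coord d y))"
  by (rule smooth_on_has_derivative[OF transition_smooth[OF assms(1,2)]]) (use assms in blast)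

lemma components_has_derivative:
  assumes "y \<in> U"
  shows "((\<phi> \<circ> chart_inv (chart_at A y)) has_derivative components y) (at (coord (chart_at A y) y))"
proof -
  have "components y = frechet_derivative (\<phi> \<circ> chart_inv (chart_at A y)) (at (coord (chart_at A y) y))"
    by (auto simp: components_def tangent_map_def)
  then show ?thesis
    using transition_has_derivative[of "chart_at A y" c y] chart_at[OF U_topspace[OF assms]] c assms by simp
qed

lemma vector_of_has_derivative:
  "y \<in> U \<Longrightarrow> ((coord (chart_at A y) \<circ> \<psi>) has_derivative vector_of y) (at (\<phi> y))"
  using transition_has_derivative[of c "chart_at A y" y] chart_at[OF U_topspace] c
  by (simp add: vector_of_def)

lemma components_linear: "y \<in> U \<Longrightarrow> linear (components y)"
  and vector_of_linear: "y \<in> U \<Longrightarrow> linear (vector_of y)"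
  using components_has_derivative vector_of_has_derivative has_derivative_linear by blast+

lemma has_derivative_change_chart:
  assumes y: "y \<in> U" and g: "(g has_derivative g') (at (\<phi> y))"
    and V: "openin M V" "V \<subseteq> U" "y \<in> V" and eq: "\<And>y'. y' \<in> V \<Longrightarrow> q y' = g (\<phi> y')"
  shows "((q \<circ> chart_inv (chart_at A y)) has_derivative (\<lambda>v. g' (components y v)))
    (at (coord (chart_at A y) y))"
proof -
  define d where "d = chart_at A y"
  have d: "d \<in> A" "y \<in> chart_dom d"
    using chart_at[OF U_topspace[OF y]] by (auto simp: d_def)
  have op: "open (coord d ` (V \<inter> chart_dom d))"
    by (rule chart_image_open[OF d(1)]) (use V(1) chart_dom_open[OF d(1)] in auto)
  have g2: "(g has_derivative g') (at ((\<phi> \<circ> chart_inv d) (coord d y)))"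
    using g chart_inv_left[OF d] by simp
  have "((\<lambda>z. g ((\<phi> \<circ> chart_inv d) z)) has_derivative (\<lambda>v. g' (components y v))) (at (coord d y))"
    using has_derivative_compose[OF components_has_derivative[OF y, folded d_def] g2] .
  then show ?thesis
    unfolding d_def[symmetric]
  proof (rule has_derivative_transform_within_open[OF _ op])
    show "coord d y \<in> coord d ` (V \<inter> chart_dom d)" using V(3) d(2) by blast
    show "g ((\<phi> \<circ> chart_inv d) z) = (q \<circ> chart_inv d) z" if "z \<in> coord d ` (V \<inter> chart_dom d)" for z
      using that eq chart_inv_left[OF d(1)] by auto
  qed
qed

text \<open>Equality of \<open>q\<close> and \<open>g \<circ> \<phi>\<close> is required near \<open>y\<close> only: coordinate maps of other charts are controlled
  only on the overlap with \<open>c\<close>.\<close>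

lemma tangent_map_eq:
  assumes "y \<in> U" "(g has_derivative g') (at (\<phi> y))"
    "openin M V" "V \<subseteq> U" "y \<in> V" "\<And>y'. y' \<in> V \<Longrightarrow> q y' = g (\<phi> y')"
  shows "tangent_map A q y v = g' (components y v)"
  using frechet_derivative_at[OF has_derivative_change_chart[OF assms]]
  unfolding tangent_map_def by metis

lemma tangent_map_in_chart:
  assumes y: "y \<in> U" and g: "(g \<circ> \<psi> has_derivative g') (at (\<phi> y))"
  shows "tangent_map A g y v = g' (components y v)"
  by (rule tangent_map_eq[OF y g chart_dom_open[OF c] subset_refl y]) (simp add: chart_inv_left[OF c])

lemma vector_of_components: "y \<in> U \<Longrightarrow> vector_of y (components y v) = v"
proof -
  assume y: "y \<in> U"
  define d where "d = chart_at A y"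
  have d: "d \<in> A" "y \<in> chart_dom d"
    using chart_at[OF U_topspace[OF y]] by (auto simp: d_def)
  have "tangent_map A (coord d) y v = vector_of y (components y v)"
    using vector_of_has_derivative[OF y] by (intro tangent_map_in_chart[OF y]) (simp add: d_def)
  moreover have "((coord d \<circ> chart_inv d) has_derivative (\<lambda>v. v)) (at (coord d y))"
    by (rule has_derivative_transform_within_open[OF has_derivative_ident
          chart_image_open[OF d(1) chart_dom_open[OF d(1)] subset_refl]])
      (use d chart_inv_left[OF d(1)] in auto)
  from frechet_derivative_at[OF this] have "tangent_map A (coord d) y v = v"
    unfolding tangent_map_def d_def by metis
  ultimately show ?thesis by simp
qed

lemma components_vector_of: "y \<in> U \<Longrightarrow> components y (vector_of y a) = a"
proof -
  assume y: "y \<in> U"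
  have "surj (vector_of y)"
    using vector_of_components[OF y] by (metis surjI)
  then have "inj (vector_of y)"
    using linear_surjective_imp_injective[OF vector_of_linear[OF y]] by simp
  then show ?thesis
    using vector_of_components[OF y] by (metis injD)
qed

lemma components_self:
  assumes "x \<in> U" "chart_at A x = c"
  shows "components x v = v" "vector_of x v = v"
proof -
  have "((\<phi> \<circ> \<psi>) has_derivative (\<lambda>v. v)) (at (\<phi> x))"
    by (rule has_derivative_transform_within_open[OF has_derivative_ident W_open])
      (use assms chart_inv_left[OF c] in auto)
  from frechet_derivative_at[OF this] show "vector_of x v = v"
    unfolding vector_of_def assms(2) by metis
  then show "components x v = v"
    using components_vector_of[OF assms(1)] by metis
qed

text \<open>Smooth components in the single chart \<open>c\<close> suffice, because transition maps are smooth.\<close>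

lemma smooth_vector_fieldI:
  assumes g: "smooth_on W g" and X: "\<And>y. y \<in> U \<Longrightarrow> components y (X y) = g (\<phi> y)"
  shows "smooth_vector_field A U X"
  unfolding smooth_vector_field_def smooth_map_def
proof (intro ballI)
  fix d d' assume d: "d \<in> A" and d': "d' \<in> A"
  define V where "V = U \<inter> chart_dom d"
  define K where "K z = frechet_derivative (coord d \<circ> \<psi>) (at z) (g z)" for z
  have V: "openin M V" unfolding V_def using chart_dom_open c d by blast
  have "open (\<phi> ` V)"
    by (rule chart_image_open[OF c V]) (simp add: V_def)
  then have K: "smooth_on (\<phi> ` V) K"
    unfolding K_def V_def
    by (intro smooth_on_directional_derivative transition_smooth c d smooth_on_subset[OF g]) auto
  have O: "open (coord d' ` (V \<inter> chart_dom d'))"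
    by (rule chart_image_open[OF d']) (use V chart_dom_open[OF d'] in auto)
  have T: "smooth_on (coord d' ` (V \<inter> chart_dom d')) (\<phi> \<circ> chart_inv d')"
    by (rule smooth_on_subset[OF transition_smooth[OF d' c]]) (auto simp: V_def)
  have "smooth_on (coord d' ` (V \<inter> chart_dom d')) (\<lambda>z. K ((\<phi> \<circ> chart_inv d') z))"
    by (rule smooth_on_compose[OF O K T]) (auto simp: chart_inv_left[OF d'])
  then show "smooth_on (coord d' ` (U \<inter> chart_dom d \<inter> chart_dom d'))
      ((\<lambda>x. tangent_map A (coord d) x (X x)) \<circ> chart_inv d')"
    unfolding V_def[symmetric]
  proof (rule smooth_on_cong[OF O, rotated])
    fix z assume "z \<in> coord d' ` (V \<inter> chart_dom d')"
    then obtain y where y: "y \<in> V" "y \<in> chart_dom d'" "z = coord d' y" by blast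
    then have yU: "y \<in> U" "y \<in> chart_dom d" by (auto simp: V_def)
    have "tangent_map A (coord d) y (X y) = frechet_derivative (coord d \<circ> \<psi>) (at (\<phi> y)) (components y (X y))"
      by (rule tangent_map_in_chart[OF yU(1) transition_has_derivative[OF c d yU]])
    then show "K ((\<phi> \<circ> chart_inv d') z) = ((\<lambda>x. tangent_map A (coord d) x (X x)) \<circ> chart_inv d') z"
      using y X[OF yU(1)] by (simp add: K_def chart_inv_left[OF d'])
  qed
qed

definition coordinate_field :: "real ^ 'n \<Rightarrow> 'm \<Rightarrow> real ^ 'n" where
  "coordinate_field a y = vector_of y a"

lemma components_coordinate_field: "y \<in> U \<Longrightarrow> components y (coordinate_field a y) = a"
  by (simp add: coordinate_field_def components_vector_of)

lemma smooth_coordinate_field: "smooth_vector_field A U (coordinate_field a)"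
  by (rule smooth_vector_fieldI[OF smooth_on_const[OF W_open]]) (rule components_coordinate_field)

text \<open>The bracket is computed in the chart chosen at \<open>y\<close>, where coordinate fields of \<open>c\<close> have the derivatives of a
  transition map as components; second derivatives of the transition map are symmetric.\<close>

lemma lie_bracket_coordinate_fields:
  assumes y: "y \<in> U"
  shows "lie_bracket A (coordinate_field a) (coordinate_field b) y = 0"
proof -
  define d where "d = chart_at A y"
  have d: "d \<in> A" "y \<in> chart_dom d"
    using chart_at[OF U_topspace[OF y]] by (auto simp: d_def)
  define V where "V = U \<inter> chart_dom d"
  have VM: "openin M V"
    unfolding V_def by (rule openin_Int[OF chart_dom_open[OF c] chart_dom_open[OF d(1)]])
  then have V: "openin M V" "V \<subseteq> U" "y \<in> V" "open (\<phi> ` V)"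
    using d y chart_image_open[OF c VM] by (auto simp: V_def)
  define G where "G a z = frechet_derivative (coord d \<circ> \<psi>) (at z) a" for a z
  have T: "smooth_on (\<phi> ` V) (coord d \<circ> \<psi>)"
    unfolding V_def by (rule transition_smooth[OF c d(1)])
  have G: "smooth_on (\<phi> ` V) (G a)" for a
    using smooth_on_derivative[OF T] by (simp add: G_def[abs_def])
  have "tangent_map A (\<lambda>y. tangent_map A (coord d) y (coordinate_field b y)) y (coordinate_field a y) =
      frechet_derivative (G b) (at (\<phi> y)) (components y (coordinate_field a y))" for a b
  proof (rule tangent_map_eq[OF y _ V(1-3)])
    show "(G b has_derivative frechet_derivative (G b) (at (\<phi> y))) (at (\<phi> y))"
      by (rule smooth_on_has_derivative[OF G]) (use V in blast)
    fix y' assume "y' \<in> V"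
    then have y': "y' \<in> U" "y' \<in> chart_dom d" by (auto simp: V_def)
    show "tangent_map A (coord d) y' (coordinate_field b y') = G b (\<phi> y')"
      using tangent_map_in_chart[OF y'(1) transition_has_derivative[OF c d(1) y']]
      by (simp add: G_def components_coordinate_field[OF y'(1)])
  qed
  moreover have "frechet_derivative (G b) (at (\<phi> y)) a = frechet_derivative (G a) (at (\<phi> y)) b"
    unfolding G_def by (rule second_derivative_symmetric[OF V(4) _ T]) (use V in blast)
  ultimately show ?thesis
    by (simp add: lie_bracket_def Let_def d_def[symmetric] components_coordinate_field[OF y])
qed

end

locale hypersurface_chart = manifold_chart M A c
  for M :: "'m topology" and A :: "('m, 'n::finite) chart set" and c :: "('m, 'n) chart" +
  fixes f \<xi> :: "'m \<Rightarrow> real ^ 'k::finite"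
    and nabla :: "('m \<Rightarrow> real ^ 'n) \<Rightarrow> ('m \<Rightarrow> real ^ 'n) \<Rightarrow> 'm \<Rightarrow> real ^ 'n"
    and h :: "'m \<Rightarrow> real ^ 'n \<Rightarrow> real ^ 'n \<Rightarrow> real"
    and S :: "'m \<Rightarrow> real ^ 'n \<Rightarrow> real ^ 'n"
    and \<tau> :: "'m \<Rightarrow> real ^ 'n \<Rightarrow> real"
  assumes card: "CARD('k) = CARD('n) + 1"
    and immersion: "immersion M A f" and transversal: "transversal_field M A f \<xi>"
    and induced: "induced_objects M A f \<xi> nabla h S \<tau>"
begin

definition F :: "real ^ 'n \<Rightarrow> real ^ 'k" where "F = f \<circ> \<psi>"
definition N :: "real ^ 'n \<Rightarrow> real ^ 'k" where "N = \<xi> \<circ> \<psi>"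

definition \<Gamma> :: "real ^ 'n \<Rightarrow> real ^ 'n \<Rightarrow> real ^ 'n \<Rightarrow> real ^ 'n" where
  "\<Gamma> a b z = components (\<psi> z) (nabla (coordinate_field a) (coordinate_field b) (\<psi> z))"

definition H :: "real ^ 'n \<Rightarrow> real ^ 'n \<Rightarrow> real ^ 'n \<Rightarrow> real" where
  "H z a b = h (\<psi> z) (coordinate_field a (\<psi> z)) (coordinate_field b (\<psi> z))"

definition Sh :: "real ^ 'n \<Rightarrow> real ^ 'n \<Rightarrow> real ^ 'n" where
  "Sh z a = components (\<psi> z) (S (\<psi> z) (coordinate_field a (\<psi> z)))"

definition t :: "real ^ 'n \<Rightarrow> real ^ 'n \<Rightarrow> real" where
  "t z a = \<tau> (\<psi> z) (coordinate_field a (\<psi> z))"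

lemma topspace_Int: "topspace M \<inter> U = U"
  using U_topspace by blast

lemma F_smooth: "smooth_on W F" and N_smooth: "smooth_on W N"
  using immersion transversal c
  by (auto simp: immersion_def transversal_field_def smooth_map_def F_def N_def topspace_Int dest!: bspec[of A _ c])

lemma psi: "z \<in> W \<Longrightarrow> \<psi> z \<in> U" "z \<in> W \<Longrightarrow> \<phi> (\<psi> z) = z"
  using chart_inv_left[OF c] by auto

lemma tangent_map_f:
  assumes "y \<in> U"
  shows "tangent_map A f y v = frechet_derivative F (at (\<phi> y)) (components y v)"
  by (rule tangent_map_in_chart[OF assms, of f, folded F_def, OF smooth_on_has_derivative[OF F_smooth]])
    (use assms in blast)

lemma tangent_map_\<xi>:
  assumes "y \<in> U"
  shows "tangent_map A \<xi> y v = frechet_derivative N (at (\<phi> y)) (components y v)"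
  by (rule tangent_map_in_chart[OF assms, of \<xi>, folded N_def, OF smooth_on_has_derivative[OF N_smooth]])
    (use assms in blast)

text \<open>The defining equation of \<open>\<nabla>\<close> and \<open>h\<close> in the chart; \<open>Y\<close> is described by its component function \<open>p\<close>.\<close>

lemma gauss_formula_in_chart:
  assumes X: "smooth_vector_field A U X" and Y: "smooth_vector_field A U Y"
    and p: "smooth_on W p" "\<And>y. y \<in> U \<Longrightarrow> components y (Y y) = p (\<phi> y)" and y: "y \<in> U"
  shows "frechet_derivative (\<lambda>z. frechet_derivative F (at z) (p z)) (at (\<phi> y)) (components y (X y)) =
    frechet_derivative F (at (\<phi> y)) (components y (nabla X Y y)) + h y (X y) (Y y) *\<^sub>R N (\<phi> y)"
proof -
  have "tangent_map A (\<lambda>y. tangent_map A f y (Y y)) y (X y) =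
     frechet_derivative (\<lambda>z. frechet_derivative F (at z) (p z)) (at (\<phi> y)) (components y (X y))"
  proof (rule tangent_map_eq[OF y _ chart_dom_open[OF c] subset_refl y])
    show "((\<lambda>z. frechet_derivative F (at z) (p z)) has_derivative
      frechet_derivative (\<lambda>z. frechet_derivative F (at z) (p z)) (at (\<phi> y))) (at (\<phi> y))"
      by (rule smooth_on_has_derivative[OF smooth_on_directional_derivative[OF W_open F_smooth p(1)]])
        (use y in blast)
    show "tangent_map A f y' (Y y') = frechet_derivative F (at (\<phi> y')) (p (\<phi> y'))" if "y' \<in> U" for y'
      by (simp add: tangent_map_f[OF that] p(2)[OF that])
  qed
  moreover have "tangent_map A (\<lambda>y. tangent_map A f y (Y y)) y (X y) =
      tangent_map A f y (nabla X Y y) + h y (X y) (Y y) *\<^sub>R \<xi> y"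
    using induced chart_dom_open[OF c] X Y y unfolding induced_objects_def by blast
  ultimately show ?thesis
    by (simp add: tangent_map_f[OF y] N_def chart_inv_left[OF c y])
qed

sublocale coordinate_hypersurface W F N \<Gamma> H Sh t
proof
  show "open W" by (rule W_open)
  show "smooth_on W F" by (rule F_smooth)
  show "smooth_on W N" by (rule N_smooth)
  show "CARD('k) = CARD('n) + 1" by (rule card)
next
  fix z assume z: "z \<in> W"
  have "range (tangent_map A f (\<psi> z)) \<subseteq> range (frechet_derivative F (at z))"
    using tangent_map_f[OF psi(1)[OF z]] psi(2)[OF z] by auto
  then have "span (insert (\<xi> (\<psi> z)) (range (tangent_map A f (\<psi> z)))) \<subseteq>
      span (insert (N z) (range (frechet_derivative F (at z))))"
    by (intro span_mono) (auto simp: N_def)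
  moreover have "span (insert (\<xi> (\<psi> z)) (range (tangent_map A f (\<psi> z)))) = UNIV"
    using transversal U_topspace[OF psi(1)[OF z]] by (simp add: transversal_field_def)
  ultimately show "span (insert (N z) (range (frechet_derivative F (at z)))) = UNIV" by blast
next
  fix z a b assume z: "z \<in> W"
  have "frechet_derivative (\<lambda>z. frechet_derivative F (at z) b) (at (\<phi> (\<psi> z)))
      (components (\<psi> z) (coordinate_field a (\<psi> z))) =
    frechet_derivative F (at (\<phi> (\<psi> z))) (components (\<psi> z) (nabla (coordinate_field a) (coordinate_field b) (\<psi> z)))
    + h (\<psi> z) (coordinate_field a (\<psi> z)) (coordinate_field b (\<psi> z)) *\<^sub>R N (\<phi> (\<psi> z))"
    by (rule gauss_formula_in_chart[OF smooth_coordinate_field smooth_coordinate_field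
          smooth_on_const[OF W_open] components_coordinate_field psi(1)[OF z]])
  then show "frechet_derivative (\<lambda>y. frechet_derivative F (at y) b) (at z) a =
     frechet_derivative F (at z) (\<Gamma> a b z) + H z a b *\<^sub>R N z"
    by (simp add: psi[OF z] components_coordinate_field \<Gamma>_def H_def)
next
  fix z a assume z: "z \<in> W"
  note y = psi(1)[OF z]
  have "tangent_map A \<xi> (\<psi> z) v = - tangent_map A f (\<psi> z) (S (\<psi> z) v) + \<tau> (\<psi> z) v *\<^sub>R \<xi> (\<psi> z)" for v
    using induced U_topspace[OF y] by (simp add: induced_objects_def)
  from this[of "coordinate_field a (\<psi> z)"]
  show "frechet_derivative N (at z) a = - frechet_derivative F (at z) (Sh z a) + t z a *\<^sub>R N z"
    by (simp add: tangent_map_f[OF y] tangent_map_\<xi>[OF y] psi(2)[OF z] components_coordinate_field[OF y]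
        Sh_def t_def N_def)
qed

text \<open>Applied to \<open>Y = \<nabla>\<^sub>bc\<close>, this computes iterated covariant derivatives. It is the reason why smoothness of
  the Christoffel symbols is needed: \<open>\<nabla>\<close> is determined only on smooth fields.\<close>

lemma nabla_in_chart:
  assumes Y: "smooth_vector_field A U Y"
    and p: "smooth_on W p" "\<And>y. y \<in> U \<Longrightarrow> components y (Y y) = p (\<phi> y)" and y: "y \<in> U"
  shows "components y (nabla (coordinate_field a) Y y) =
     \<Gamma> a (p (\<phi> y)) (\<phi> y) + frechet_derivative p (at (\<phi> y)) a"
proof -
  have z: "\<phi> y \<in> W" using y by blast
  have "dF (\<phi> y) (components y (nabla (coordinate_field a) Y y)) + h y (coordinate_field a y) (Y y) *\<^sub>R N (\<phi> y) =
    dF (\<phi> y) (\<Gamma> a (p (\<phi> y)) (\<phi> y) + frechet_derivative p (at (\<phi> y)) a) + H (\<phi> y) a (p (\<phi> y)) *\<^sub>R N (\<phi> y)"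
    using gauss_formula_in_chart[OF smooth_coordinate_field Y p y, of a] gauss_field[OF z p(1), of a]
    by (simp add: components_coordinate_field[OF y])
  from frame_unique(1)[OF z this] show ?thesis .
qed

lemma nabla_zero_field:
  assumes X: "\<And>y. y \<in> U \<Longrightarrow> X y = 0" and y: "y \<in> U"
  shows "nabla X (coordinate_field b) y = 0"
proof -
  have z: "\<phi> y \<in> W" using y by blast
  have sX: "smooth_vector_field A U X"
    by (rule smooth_vector_fieldI[OF smooth_on_const[OF W_open, of 0]])
      (simp add: X linear_0[OF components_linear])
  have dl: "linear (frechet_derivative (\<lambda>z. dF z b) (at (\<phi> y)))"
    by (rule has_derivative_linear[OF smooth_on_has_derivative[OF smooth_on_derivative[OF F_smooth] z]])
  have "dF (\<phi> y) (components y (nabla X (coordinate_field b) y)) + h y (X y) (coordinate_field b y) *\<^sub>R N (\<phi> y)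
     = dF (\<phi> y) 0 + 0 *\<^sub>R N (\<phi> y)"
    using gauss_formula_in_chart[OF sX smooth_coordinate_field smooth_on_const[OF W_open]
          components_coordinate_field y, of b]
    by (simp add: X[OF y] linear_0[OF components_linear[OF y]] linear_0[OF dl] linear_0[OF dF_linear[OF z]])
  from frame_unique(1)[OF z this] have "components y (nabla X (coordinate_field b) y) = 0" .
  then show ?thesis
    using vector_of_components[OF y] linear_0[OF vector_of_linear[OF y]] by metis
qed

text \<open>At the centre \<open>x\<close> of the argument, \<open>c\<close> is the chart chosen at \<open>x\<close>, and tangent vectors coincide with their
  components. Every tangent vector at \<open>x\<close> is thus the value of a coordinate field, to which the equations in
  coordinates apply.\<close>

theorem pointwise_equations:
  assumes x: "x \<in> U" "chart_at A x = c"
    and R: "curvature_tensor M A nabla R" and closed: "closed_one_form M A \<tau>"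
  shows "bilinear (h x)" and "h x a b = h x b a" and "linear (S x)"
    and "h x (S x a) b = h x a (S x b)"
    and "R x a b d = h x b d *\<^sub>R S x a - h x a d *\<^sub>R S x b"
proof -
  define z where "z = \<phi> x"
  have z: "z \<in> W" and psi: "\<psi> z = x"
    using x(1) chart_inv_left[OF c] by (auto simp: z_def)
  note self = components_self[OF x]
  have cf: "coordinate_field a x = a" for a
    by (simp add: coordinate_field_def self)
  have H: "H z = h x" and Sh: "Sh z = S x" and t0: "t z = \<tau> x"
    by (auto simp: fun_eq_iff H_def Sh_def t_def psi cf self)
  show "bilinear (h x)" using H_bilinear[OF z] by (simp add: H)
  show sym: "h x a b = h x b a" for a b using H_sym[OF z] by (simp add: H)
  show "linear (S x)" using Sh_linear[OF z] by (simp add: Sh)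
  note opU = chart_dom_open[OF c]
  show "h x (S x a) b = h x a (S x b)"
  proof -
    have br: "lie_bracket A (coordinate_field a) (coordinate_field b) x = 0"
      by (rule lie_bracket_coordinate_fields[OF x(1)])
    have tm: "tangent_map A (\<lambda>y. \<tau> y (coordinate_field b y)) x (coordinate_field a x) =
        frechet_derivative (\<lambda>y. t y b) (at z) a" for a b
    proof -
      have "tangent_map A (\<lambda>y. \<tau> y (coordinate_field b y)) x (coordinate_field a x) =
        frechet_derivative (\<lambda>y. t y b) (at z) (components x (coordinate_field a x))"
        unfolding z_def
        by (rule tangent_map_eq[OF x(1) smooth_on_has_derivative[OF t_smooth] opU subset_refl x(1)])
          (use x(1) in \<open>auto simp: t_def chart_inv_left[OF c]\<close>)
      then show ?thesis by (simp add: cf self)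
    qed
    have "tangent_map A (\<lambda>y. \<tau> y (coordinate_field b y)) x (coordinate_field a x)
       - tangent_map A (\<lambda>y. \<tau> y (coordinate_field a y)) x (coordinate_field b x)
       - \<tau> x (lie_bracket A (coordinate_field a) (coordinate_field b) x) = 0"
      using closed opU smooth_coordinate_field x(1) unfolding closed_one_form_def by blast
    then have "frechet_derivative (\<lambda>y. t y b) (at z) a - frechet_derivative (\<lambda>y. t y a) (at z) b = 0"
      using t_zero[OF z] by (simp add: tm br t0)
    then show ?thesis
      using coordinate_ricci_equation[OF z, of a b] sym by (simp add: H Sh)
  qed
  show "R x a b d = h x b d *\<^sub>R S x a - h x a d *\<^sub>R S x b"
  proof -
    have comp: "components y (nabla (coordinate_field a) (coordinate_field b) y) = \<Gamma> a b (\<phi> y)"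
      if "y \<in> U" for a b y
      by (simp add: \<Gamma>_def chart_inv_left[OF c that])
    have nn: "nabla (coordinate_field a) (nabla (coordinate_field b) (coordinate_field d)) x =
        \<Gamma> a (\<Gamma> b d z) z + frechet_derivative (\<Gamma> b d) (at z) a" for a b
      using nabla_in_chart[OF smooth_vector_fieldI[OF \<Gamma>_smooth comp] \<Gamma>_smooth comp x(1), of a]
      by (simp add: self z_def)
    have br: "nabla (lie_bracket A (coordinate_field a) (coordinate_field b)) (coordinate_field d) x = 0"
      by (rule nabla_zero_field[OF lie_bracket_coordinate_fields x(1)])
    have "R x (coordinate_field a x) (coordinate_field b x) (coordinate_field d x) =
       nabla (coordinate_field a) (nabla (coordinate_field b) (coordinate_field d)) x
       - nabla (coordinate_field b) (nabla (coordinate_field a) (coordinate_field d)) x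
       - nabla (lie_bracket A (coordinate_field a) (coordinate_field b)) (coordinate_field d) x"
      using R opU smooth_coordinate_field x(1) unfolding curvature_tensor_def by blast
    then show ?thesis
      using coordinate_gauss_equation[OF z, of a b d] by (simp add: cf nn br H Sh)
  qed
qed

end

section \<open>The rank of the shape operator\<close>

theorem theorem5p7:
  fixes M :: "'m topology"
    and A :: "('m, 'n::finite) chart set"
    and f \<xi> :: "'m \<Rightarrow> real ^ 'k::finite"
    and nabla :: "('m \<Rightarrow> real ^ 'n) \<Rightarrow> ('m \<Rightarrow> real ^ 'n) \<Rightarrow> 'm \<Rightarrow> real ^ 'n"
    and h \<omega> :: "'m \<Rightarrow> real ^ 'n \<Rightarrow> real ^ 'n \<Rightarrow> real"
    and S :: "'m \<Rightarrow> real ^ 'n \<Rightarrow> real ^ 'n"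
    and \<tau> :: "'m \<Rightarrow> real ^ 'n \<Rightarrow> real"
    and R :: "'m \<Rightarrow> real ^ 'n \<Rightarrow> real ^ 'n \<Rightarrow> real ^ 'n \<Rightarrow> real ^ 'n"
    and n k :: nat
  assumes "CARD('n) = 2 * n" and "2 * n \<ge> 4" and "CARD('k) = 2 * n + 1"
    and "smooth_manifold M A" and "connected_space M" and "orientable M A"
    and "immersion M A f" and "transversal_field M A f \<xi>"
    and "induced_objects M A f \<xi> nabla h S \<tau>"
    and "nondegenerate M h"
    and "closed_one_form M A \<tau>"
    and "curvature_tensor M A nabla R"
    and "almost_symplectic_form M A \<omega>"
    and "k \<ge> 1"
    and "\<forall>x\<in>topspace M. \<forall>Xs. length Xs = 2 * k + 2 \<longrightarrow>
           curvature_power R k (form_tensor \<omega>) x Xs = 0"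
  shows "\<forall>x\<in>topspace M. dim (range (S x)) \<le> 1"
proof
  fix x assume x: "x \<in> topspace M"
  have atlas: "smooth_atlas M A"
    using \<open>smooth_manifold M A\<close> by (simp add: smooth_manifold_def)
  then have "(\<Union>c\<in>A. chart_dom c) = topspace M"
    by (simp add: smooth_atlas_def)
  then have "\<exists>c. c \<in> A \<and> x \<in> chart_dom c"
    using x by blast
  then have c: "chart_at A x \<in> A" "x \<in> chart_dom (chart_at A x)"
    unfolding chart_at_def by (rule someI2_ex, blast)+
  interpret chart: hypersurface_chart M A "chart_at A x" f \<xi> nabla h S \<tau>
    using atlas c assms by unfold_locales simp_all
  note eqs = chart.pointwise_equations[OF c(2) refl \<open>curvature_tensor M A nabla R\<close>
      \<open>closed_one_form M A \<tau>\<close>]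
  interpret point: gauss_curvature "h x" "S x"
  proof (rule gauss_curvature.intro)
    show "u = 0" if "\<And>v. h x u v = 0" for u
      using that \<open>nondegenerate M h\<close> x by (simp add: nondegenerate_def)
  qed (fact eqs)+
  have R: "R x = point.R"
    by (intro ext) (simp add: eqs(5) point.R_def)
  have \<omega>: "bilinear (\<omega> x)" "\<And>u. \<omega> x u u = 0" "\<And>u. (\<And>v. \<omega> x u v = 0) \<Longrightarrow> u = 0"
    using \<open>almost_symplectic_form M A \<omega>\<close> x by (auto simp: almost_symplectic_form_def nondegenerate_def)
  have skew: "\<omega> x v u = - \<omega> x u v" for u v
    using \<omega>(2)[of "u + v"] \<omega>(2)[of u] \<omega>(2)[of v]
    unfolding bilinear_ladd[OF \<omega>(1)] bilinear_radd[OF \<omega>(1)] by linarith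
  have van: "point.Rpow k (\<lambda>L. \<omega> x (L ! 0) (L ! 1)) Xs = 0" if "length Xs = 2 * k + 2" for Xs
    using curvature_power_pointwise[OF that, of R \<omega> x] assms(15) x that by (simp add: R)
  have "point.rank_le_1"
    by (rule point.vanishing_curvature_power_imp_rank[OF _ \<omega>(1) skew \<omega>(3) \<open>k \<ge> 1\<close> van])
      (use assms(1,2) in simp_all)
  then obtain v where "range (S x) \<subseteq> span {v}"
    by (auto simp: point.rank_le_1_def)
  then have "dim (range (S x)) \<le> card {v}"
    by (rule dim_le_card) simp
  then show "dim (range (S x)) \<le> 1" by simp
qed

end
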